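(* Let $f$ be a function and suppose, with $D_n^L=D_{1,n}^L+D_{2,n}^L$: (a) $\sup_{c\in I_n}\frac{|R_{1,n}^L(c,f)|+|R_{2,n}^L(c)|}{D_n^L(c,f)}\to0$ and $\sup_{c\in I_n}\frac{|R_{3,n}(c,f)|+|R_{4,n}(c)|}{D_n^L(c,f)}\to0$ in $P_f$-probability; (b) $D_{2,n}^L$ is a good variance function (see context) with $D_{2,n}^L(c)\ge\log(nc)$ for $c\in I_n$; (c) there is a minimizer $c_n(f)$ of $c\mapsto D_n^L(c,f)+2\lambda/c$ over $c\in(0,\infty)$ that satisfies $c_n(f)\in I_n$ and $2c_n(f)\in I_n$; (d) $D_{2,n}^R(c)\asymp D_{2,n}^L(c)\asymp s_n^2(c)$ uniformly in $c\in I_n$. Then the square of the diameter of the hierarchical Bayes credible sets $$\hat C_{n,\eta,M}=\bigcup_{\hat c_{1,n}(\eta_1)<c<\hat c_{2,n}(\eta_1)}\bigl\{w:\|\vec w_n-\hat f_{n,c}\|<Mr_n(c,\eta_2)\bigr\}$$ (measured in the Euclidean norm of the vectors $\vec w_n$) is of the order $\inf_{c\in I_n}\bigl[D_n^L(c,f)+1/c\bigr]$ with probability tending to one; that is, there is a constant $K$ such that $P_f\bigl(\operatorname{diam}(\hat C_{n,\eta,M})^2\le K\inf_{c\in I_n}[D_n^L(c,f)+1/c]\bigr)\to1$.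
   Context: Setting. $\mathcal X$ is a set and for each $n$, $x_{1,n},\dots,x_{n,n}\in\mathcal X$ are known design points. For $f:\mathcal X\to\mathbb R$ write $\vec f_n=(f(x_{1,n}),\dots,f(x_{n,n}))^T$. Under $P_f$ one observes $\vec Y_n=\vec f_n+\vec\varepsilon_n$ with $\vec\varepsilon_n\sim\mathcal N_n(0,I)$. $W^1$ is a mean-zero Gaussian process on $\mathcal X$; $U_n$ is the covariance matrix of $(W^1_{x_{1,n}},\dots,W^1_{x_{n,n}})$, with orthonormal eigenbasis $e_{1,n},\dots,e_{n,n}$ and eigenvalues $\lambda_{1,n},\dots,\lambda_{n,n}$; $f_{j,n}=\vec f_n^Te_{j,n}$, $Z_{j,n}=\vec\varepsilon_n^Te_{j,n}$ (i.i.d. standard normal); $\Sigma_{n,c}=I+cU_n$; $\hat f_{n,c}=(I-\Sigma_{n,c}^{-1})\vec Y_n$. $I_n=[\log n/n,n^{m-1}]$ for a fixed constant $m\ge1$. $r_n(c,\eta_2)$ is the number such that the centered Euclidean ball of radius $r_n(c,\eta_2)$ has probability $\eta_2\in(0,1)$ under $\mathcal N_n(0,I-\Sigma_{n,c}^{-1})$. $M>0$ is fixed. Hierarchical Bayes: $c$ has prior density $\pi(c)\propto c^{-1-\kappa}e^{-\lambda/c}$ for $c\in I_n$ (zero elsewhere), with fixed $\kappa,\lambda>0$; given $c$, $f$ is distributed as $\sqrt c\,W^1$; given $f,c$, $\vec Y_n\sim\mathcal N_n(\vec f_n,I)$. $\hat c_{1,n}(\eta_1)<\hat c_{2,n}(\eta_1)$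 are two quantiles, at fixed levels strictly between 0 and 1 (determined by $\eta_1\in(0,1)$), of the posterior distribution of $c$ given $\vec Y_n$ (density proportional to $(\det\Sigma_{n,c})^{-1/2}e^{-\frac12\vec Y_n^T\Sigma_{n,c}^{-1}\vec Y_n}\pi(c)$). $\eta=(\eta_1,\eta_2)$. Functions: $D_{1,n}^L(c,f)=\sum_{j=1}^n\frac{f_{j,n}^2}{1+c\lambda_{j,n}}$, $D_{2,n}^L(c)=\sum_{j=1}^n\bigl[\log(1+c\lambda_{j,n})-\frac{c\lambda_{j,n}}{1+c\lambda_{j,n}}\bigr]$, $D_{2,n}^R(c)=\sum_{j=1}^n\frac{(c\lambda_{j,n})^2}{(1+c\lambda_{j,n})^2}$, $R_{1,n}^L(c,f)=2\sum_{j=1}^n\frac{Z_{j,n}f_{j,n}}{1+c\lambda_{j,n}}$, $R_{2,n}^L(c)=-\sum_{j=1}^n\frac{(Z_{j,n}^2-1)c\lambda_{j,n}}{1+c\lambda_{j,n}}$, $R_{3,n}(c,f)=-2\sum_{j=1}^n\frac{c\lambda_{j,n}Z_{j,n}f_{j,n}}{(1+c\lambda_{j,n})^2}$, $R_{4,n}(c)=\sum_{j=1}^n\frac{(c\lambda_{j,n})^2(Z_{j,n}^2-1)}{(1+c\lambda_{j,n})^2}$, $s_n^2(c)=\sum_{j=1}^n\frac{c\lambda_{j,n}}{1+c\lambda_{j,n}}$. Good variance function: there are $b,B,B'>0$ (independent of $n$) with $Bk^bD_{2,n}^L(c)\le D_{2,n}^L(kc)\le B'k^bD_{2,n}^L(c)$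 for all $c\in I_n$ and $k\in(0,1)$ with $kc\in I_n$. $a_n\asymp b_n$ uniformly means that $a_n/b_n$ is bounded away from $0$ and $\infty$ by the same constants over the domain, for large $n$. *)

theory Defs
  imports
    "HOL-Probability.Probability"
    "Jordan_Normal_Form.Gauss_Jordan_Elimination"
    "Jordan_Normal_Form.Determinant"
begin

unbundle no inner_syntax and no vec_syntax

text \<open>
  Vectors and matrices of the varying size \<open>n\<close> are those of \<open>Jordan_Normal_Form\<close>; indices run over
  \<open>{..<n}\<close> instead of \<open>{1..n}\<close>. Fixed data of the model: the design points \<open>x n i\<close> (\<open>i < n\<close>), the
  process \<open>W\<close> on the probability space \<open>\<Omega>\<close>, and for each \<open>n\<close> an eigenbasis \<open>e n j\<close> with eigenvalues
  \<open>\<mu> n j\<close> (\<open>j < n\<close>) of the covariance matrix of \<open>W\<close> at the design points.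
\<close>

subsection \<open>Euclidean vectors and Gaussian laws\<close>

definition vnorm :: "real Matrix.vec \<Rightarrow> real" where
  "vnorm v = sqrt (v \<bullet> v)"

definition mat_inv :: "real mat \<Rightarrow> real mat" where
  "mat_inv A = the (mat_inverse A)"

text \<open>The law \<open>N\<^sub>n(0, I)\<close>, on functions \<open>{..<n} \<rightarrow> real\<close>.\<close>

definition std_gaussian :: "nat \<Rightarrow> (nat \<Rightarrow> real) measure" where
  "std_gaussian n = PiM {..<n} (\<lambda>_. density lborel std_normal_density)"

text \<open>
  The law \<open>N\<^sub>n(0, A)\<close> for positive semidefinite, possibly singular \<open>A\<close>: the law of \<open>B \<xi>\<close>, where \<open>\<xi>\<close> is
  standard normal and \<open>B\<close> is any matrix with \<open>B B\<^sup>T = A\<close>. The law does not depend on the choice of \<open>B\<close>.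
\<close>

definition gaussian_law :: "nat \<Rightarrow> real mat \<Rightarrow> (nat \<Rightarrow> real) measure" where
  "gaussian_law n A =
     (let B = (SOME B. B \<in> carrier_mat n n \<and> B * B\<^sup>T = A)
      in distr (std_gaussian n) (PiM {..<n} (\<lambda>_. borel))
           (\<lambda>\<xi>. \<lambda>i\<in>{..<n}. (B *\<^sub>v Matrix.vec n \<xi>) $ i))"

text \<open>A one-dimensional centred normal law; variance \<open>0\<close> is allowed.\<close>

definition centred_normal :: "real measure \<Rightarrow> bool" where
  "centred_normal \<nu> \<longleftrightarrow>
     \<nu> = return borel 0 \<or> (\<exists>\<sigma>>0. \<nu> = density lborel (normal_density 0 \<sigma>))"

definition centred_gaussian_process :: "'w measure \<Rightarrow> ('x \<Rightarrow> 'w \<Rightarrow> real) \<Rightarrow> bool" where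
  "centred_gaussian_process \<Omega> W \<longleftrightarrow>
     prob_space \<Omega> \<and> (\<forall>t. W t \<in> borel_measurable \<Omega>) \<and>
     (\<forall>T a. finite T \<longrightarrow> centred_normal (distr \<Omega> borel (\<lambda>\<omega>. \<Sum>t\<in>T. a t * W t \<omega>)))"

subsection \<open>The regression model\<close>

definition design_vec :: "(nat \<Rightarrow> nat \<Rightarrow> 'x) \<Rightarrow> ('x \<Rightarrow> real) \<Rightarrow> nat \<Rightarrow> real Matrix.vec" where
  "design_vec x f n = Matrix.vec n (\<lambda>i. f (x n i))"

text \<open>The observation, as a function of the noise \<open>\<epsilon>\<close>; \<open>P\<^sub>f\<close> is the law \<open>std_gaussian n\<close> of \<open>\<epsilon>\<close>.\<close>

definition obs :: "(nat \<Rightarrow> nat \<Rightarrow> 'x) \<Rightarrow> ('x \<Rightarrow> real) \<Rightarrow> nat \<Rightarrow> (nat \<Rightarrow> real) \<Rightarrow> real Matrix.vec" where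
  "obs x f n \<epsilon> = design_vec x f n + Matrix.vec n \<epsilon>"

text \<open>Since \<open>W\<close> has mean zero, the covariances are the mixed second moments.\<close>

definition cov_mat :: "'w measure \<Rightarrow> ('x \<Rightarrow> 'w \<Rightarrow> real) \<Rightarrow> (nat \<Rightarrow> nat \<Rightarrow> 'x) \<Rightarrow> nat \<Rightarrow> real mat" where
  "cov_mat \<Omega> W x n = mat n n (\<lambda>(i, j). LINT \<omega>|\<Omega>. W (x n i) \<omega> * W (x n j) \<omega>)"

definition orthonormal_eigenbasis ::
    "nat \<Rightarrow> real mat \<Rightarrow> (nat \<Rightarrow> real Matrix.vec) \<Rightarrow> (nat \<Rightarrow> real) \<Rightarrow> bool" where
  "orthonormal_eigenbasis n A b l \<longleftrightarrow>
     (\<forall>j<n. b j \<in> carrier_vec n \<and> A *\<^sub>v b j = l j \<cdot>\<^sub>v b j) \<and>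
     (\<forall>i<n. \<forall>j<n. b i \<bullet> b j = (if i = j then 1 else 0))"

definition Sigma_mat :: "nat \<Rightarrow> real mat \<Rightarrow> real \<Rightarrow> real mat" where
  "Sigma_mat n U c = 1\<^sub>m n + c \<cdot>\<^sub>m U"

definition fhat :: "nat \<Rightarrow> real mat \<Rightarrow> real \<Rightarrow> real Matrix.vec \<Rightarrow> real Matrix.vec" where
  "fhat n U c y = (1\<^sub>m n - mat_inv (Sigma_mat n U c)) *\<^sub>v y"

text \<open>The \<open>r\<close> below exists uniquely for \<open>\<eta> \<in> (0,1)\<close>, \<open>c > 0\<close> and \<open>U \<noteq> 0\<close> a covariance matrix.\<close>

definition radius :: "nat \<Rightarrow> real mat \<Rightarrow> real \<Rightarrow> real \<Rightarrow> real" where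
  "radius n U c \<eta> =
     (let G = gaussian_law n (1\<^sub>m n - mat_inv (Sigma_mat n U c))
      in THE r. measure G {g \<in> space G. vnorm (Matrix.vec n g) < r} = \<eta>)"

definition scale_range :: "real \<Rightarrow> nat \<Rightarrow> real set" where
  "scale_range m n = {ln (real n) / real n .. real n powr (m - 1)}"

subsection \<open>Hierarchical Bayes\<close>

definition normalize_density :: "(real \<Rightarrow> real) \<Rightarrow> real \<Rightarrow> real" where
  "normalize_density g c = g c / (LINT t|lborel. g t)"

definition prior_density :: "real \<Rightarrow> real \<Rightarrow> real \<Rightarrow> nat \<Rightarrow> real \<Rightarrow> real" where
  "prior_density m \<kappa> lam n =
     normalize_density
       (\<lambda>c. if c \<in> scale_range m n then c powr (- 1 - \<kappa>) * exp (- lam / c) else 0)"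

text \<open>
  Integrating out \<open>f\<close>, the observation \<open>y\<close> given \<open>c\<close> is \<open>N\<^sub>n(0, \<Sigma>\<^bsub>n,c\<^esub>)\<close>-distributed, which gives the
  likelihood factor below (the constant \<open>(2\<pi>)\<close>-power cancels).
\<close>

definition posterior ::
    "real \<Rightarrow> real \<Rightarrow> real \<Rightarrow> nat \<Rightarrow> real mat \<Rightarrow> real Matrix.vec \<Rightarrow> real measure" where
  "posterior m \<kappa> lam n U y =
     density lborel (normalize_density
       (\<lambda>c. Determinant.det (Sigma_mat n U c) powr (- 1 / 2)
            * exp (- (1 / 2) * (y \<bullet> (mat_inv (Sigma_mat n U c) *\<^sub>v y)))
            * prior_density m \<kappa> lam n c))"

definition quantile :: "real measure \<Rightarrow> real \<Rightarrow> real" where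
  "quantile \<nu> \<alpha> = Inf {t. \<alpha> \<le> cdf \<nu> t}"

text \<open>\<open>p\<^sub>1 < p\<^sub>2\<close> are the levels of the two posterior quantiles, \<open>C\<close> is the inflation factor of the radius.\<close>

definition hb_credible_set ::
    "real \<Rightarrow> real \<Rightarrow> real \<Rightarrow> real \<Rightarrow> real \<Rightarrow> real \<Rightarrow> real
     \<Rightarrow> (nat \<Rightarrow> nat \<Rightarrow> 'x) \<Rightarrow> nat \<Rightarrow> real mat \<Rightarrow> real Matrix.vec \<Rightarrow> ('x \<Rightarrow> real) set" where
  "hb_credible_set m \<kappa> lam p\<^sub>1 p\<^sub>2 \<eta>\<^sub>2 C x n U y =
     (let \<nu> = posterior m \<kappa> lam n U y
      in \<Union>c\<in>{quantile \<nu> p\<^sub>1 <..< quantile \<nu> p\<^sub>2}.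
           {w. vnorm (design_vec x w n - fhat n U c y) < C * radius n U c \<eta>\<^sub>2})"

definition design_diameter :: "(nat \<Rightarrow> nat \<Rightarrow> 'x) \<Rightarrow> nat \<Rightarrow> ('x \<Rightarrow> real) set \<Rightarrow> real" where
  "design_diameter x n S =
     (if S = {} then 0
      else SUP (v, w)\<in>S \<times> S. vnorm (design_vec x v n - design_vec x w n))"

subsection \<open>Deterministic and stochastic terms\<close>

definition f_coef ::
    "(nat \<Rightarrow> nat \<Rightarrow> 'x) \<Rightarrow> (nat \<Rightarrow> nat \<Rightarrow> real Matrix.vec) \<Rightarrow> ('x \<Rightarrow> real) \<Rightarrow> nat \<Rightarrow> nat \<Rightarrow> real" where
  "f_coef x e f n j = design_vec x f n \<bullet> e n j"

definition Z_coef :: "(nat \<Rightarrow> nat \<Rightarrow> real Matrix.vec) \<Rightarrow> nat \<Rightarrow> (nat \<Rightarrow> real) \<Rightarrow> nat \<Rightarrow> real" where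
  "Z_coef e n \<epsilon> j = Matrix.vec n \<epsilon> \<bullet> e n j"

definition D1L ::
    "(nat \<Rightarrow> nat \<Rightarrow> 'x) \<Rightarrow> (nat \<Rightarrow> nat \<Rightarrow> real Matrix.vec)
     \<Rightarrow> (nat \<Rightarrow> nat \<Rightarrow> real) \<Rightarrow> ('x \<Rightarrow> real) \<Rightarrow> nat \<Rightarrow> real \<Rightarrow> real" where
  "D1L x e \<mu> f n c = (\<Sum>j<n. (f_coef x e f n j)\<^sup>2 / (1 + c * \<mu> n j))"

definition D2L :: "(nat \<Rightarrow> nat \<Rightarrow> real) \<Rightarrow> nat \<Rightarrow> real \<Rightarrow> real" where
  "D2L \<mu> n c = (\<Sum>j<n. ln (1 + c * \<mu> n j) - c * \<mu> n j / (1 + c * \<mu> n j))"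

definition DL ::
    "(nat \<Rightarrow> nat \<Rightarrow> 'x) \<Rightarrow> (nat \<Rightarrow> nat \<Rightarrow> real Matrix.vec)
     \<Rightarrow> (nat \<Rightarrow> nat \<Rightarrow> real) \<Rightarrow> ('x \<Rightarrow> real) \<Rightarrow> nat \<Rightarrow> real \<Rightarrow> real" where
  "DL x e \<mu> f n c = D1L x e \<mu> f n c + D2L \<mu> n c"

definition D2R :: "(nat \<Rightarrow> nat \<Rightarrow> real) \<Rightarrow> nat \<Rightarrow> real \<Rightarrow> real" where
  "D2R \<mu> n c = (\<Sum>j<n. (c * \<mu> n j)\<^sup>2 / (1 + c * \<mu> n j)\<^sup>2)"

definition s2 :: "(nat \<Rightarrow> nat \<Rightarrow> real) \<Rightarrow> nat \<Rightarrow> real \<Rightarrow> real" where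
  "s2 \<mu> n c = (\<Sum>j<n. c * \<mu> n j / (1 + c * \<mu> n j))"

definition R1L ::
    "(nat \<Rightarrow> nat \<Rightarrow> 'x) \<Rightarrow> (nat \<Rightarrow> nat \<Rightarrow> real Matrix.vec)
     \<Rightarrow> (nat \<Rightarrow> nat \<Rightarrow> real) \<Rightarrow> ('x \<Rightarrow> real) \<Rightarrow> nat \<Rightarrow> (nat \<Rightarrow> real) \<Rightarrow> real \<Rightarrow> real" where
  "R1L x e \<mu> f n \<epsilon> c =
     2 * (\<Sum>j<n. Z_coef e n \<epsilon> j * f_coef x e f n j / (1 + c * \<mu> n j))"

definition R2L ::
    "(nat \<Rightarrow> nat \<Rightarrow> real Matrix.vec) \<Rightarrow> (nat \<Rightarrow> nat \<Rightarrow> real) \<Rightarrow> nat \<Rightarrow> (nat \<Rightarrow> real) \<Rightarrow> real \<Rightarrow> real" where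
  "R2L e \<mu> n \<epsilon> c =
     - (\<Sum>j<n. ((Z_coef e n \<epsilon> j)\<^sup>2 - 1) * (c * \<mu> n j) / (1 + c * \<mu> n j))"

definition R3 ::
    "(nat \<Rightarrow> nat \<Rightarrow> 'x) \<Rightarrow> (nat \<Rightarrow> nat \<Rightarrow> real Matrix.vec)
     \<Rightarrow> (nat \<Rightarrow> nat \<Rightarrow> real) \<Rightarrow> ('x \<Rightarrow> real) \<Rightarrow> nat \<Rightarrow> (nat \<Rightarrow> real) \<Rightarrow> real \<Rightarrow> real" where
  "R3 x e \<mu> f n \<epsilon> c =
     - 2 * (\<Sum>j<n. c * \<mu> n j * Z_coef e n \<epsilon> j * f_coef x e f n j / (1 + c * \<mu> n j)\<^sup>2)"

definition R4 ::
    "(nat \<Rightarrow> nat \<Rightarrow> real Matrix.vec) \<Rightarrow> (nat \<Rightarrow> nat \<Rightarrow> real) \<Rightarrow> nat \<Rightarrow> (nat \<Rightarrow> real) \<Rightarrow> real \<Rightarrow> real" where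
  "R4 e \<mu> n \<epsilon> c =
     (\<Sum>j<n. (c * \<mu> n j)\<^sup>2 * ((Z_coef e n \<epsilon> j)\<^sup>2 - 1) / (1 + c * \<mu> n j)\<^sup>2)"

subsection \<open>Asymptotic notions\<close>

definition tendsto_in_prob :: "(nat \<Rightarrow> 'a measure) \<Rightarrow> (nat \<Rightarrow> 'a \<Rightarrow> real) \<Rightarrow> real \<Rightarrow> bool" where
  "tendsto_in_prob P X l \<longleftrightarrow>
     (\<forall>\<delta>>0. (\<lambda>n. measure (P n) {\<omega> \<in> space (P n). \<bar>X n \<omega> - l\<bar> > \<delta>}) \<longlonglongrightarrow> 0)"

text \<open>
  Conditions indexed by \<open>n\<close> are asymptotic: they are required for all large \<open>n\<close>, with constants that
  do not depend on \<open>n\<close>.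
\<close>

definition good_variance_function :: "(nat \<Rightarrow> real set) \<Rightarrow> (nat \<Rightarrow> real \<Rightarrow> real) \<Rightarrow> bool" where
  "good_variance_function I D \<longleftrightarrow>
     (\<exists>b>0. \<exists>B>0. \<exists>B'>0. \<forall>\<^sub>F n in sequentially. \<forall>c\<in>I n. \<forall>k\<in>{0<..<1}. k * c \<in> I n \<longrightarrow>
        B * k powr b * D n c \<le> D n (k * c) \<and> D n (k * c) \<le> B' * k powr b * D n c)"

definition unif_asymp ::
    "(nat \<Rightarrow> real set) \<Rightarrow> (nat \<Rightarrow> real \<Rightarrow> real) \<Rightarrow> (nat \<Rightarrow> real \<Rightarrow> real) \<Rightarrow> bool" where
  "unif_asymp I a b \<longleftrightarrow>
     (\<exists>k>0. \<exists>K. \<forall>\<^sub>F n in sequentially. \<forall>c\<in>I n. k \<le> a n c / b n c \<and> a n c / b n c \<le> K)"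

end

theory Submission
  imports Defs
begin

text \<open>
  Write \<open>G c = D c + 2 \<lambda> / c\<close> with minimum \<open>g\<close>. Twice the negative log likelihood of \<open>c\<close> equals
  \<open>D + R\<^sub>1 + R\<^sub>2\<close> up to a constant, so where the remainders are small relative to \<open>D\<close> the unnormalized
  posterior mass of \<open>{c. G c \<ge> K g}\<close> is at most a constant times \<open>exp (- (5 + \<kappa>) g)\<close> for
  \<open>K = 8 (5 + \<kappa>)\<close>, whereas \<open>{c\<^sub>n..2 c\<^sub>n}\<close> alone contributes at least a constant times
  \<open>exp (- (4 + \<kappa>) g)\<close>, since \<open>G\<close> at most quadruples there and \<open>c\<^sub>n \<le> exp g\<close>. As
  \<open>g \<ge> ln (n c\<^sub>n) \<ge> ln (ln n)\<close> diverges, this mass is eventually smaller than both tail levels. \<open>G\<close> is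
  the sum of a decreasing and an increasing function, so every \<open>c\<close> between the two quantiles has
  \<open>G c \<le> (K + 1) g\<close>; for such \<open>c\<close> both the squared distance of the centre to \<open>f\<close> and the squared
  radius are of the order \<open>D c\<close>.

  All probabilities are those of measurable events because the noises for which a given function lies
  in the credible set form an open set: the posterior distribution function is continuous in the noise.
\<close>

text \<open>The tail estimate must be uniform in \<open>n\<close> although the left end of
  \<open>scale_range m n\<close> tends to 0, where \<open>t powr (- 1 - \<kappa>)\<close> is not
  integrable. Hence only a quarter of the prior exponent \<open>lam / t\<close> is spent on
  smallness; three quarters stay under the integral. With noise at most \<open>D t / 2\<close> the
  exponent to spend is \<open>D t / 4 + lam / (4 * t)\<close>, at least one eighth of
  \<open>D t + 2 * lam / t\<close>: this is the 8 in \<open>8 * (5 + \<kappa>)\<close>. The 5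
  exceeds by one the 4 in the lower bound for the total mass, so a factor \<open>exp (- g)\<close>
  survives in the quotient. A second concern is what the terms denote: \<open>measure\<close> is 0
  on nonmeasurable sets, while a real \<open>SUP\<close> over an unbounded set and
  \<open>THE\<close> without a unique witness are unspecified. Therefore the radius is shown to
  exist uniquely, the credible set to be bounded for every noise, not only for likely ones, and each
  event to be measurable. Uncountable unions, over scales or pairs of functions, are harmless
  because their members are open.\<close>

section \<open>Linear algebra in an orthonormal eigenbasis\<close>

lemma sum_prod_kronecker:
  fixes g :: "nat \<Rightarrow> real"
  assumes "j < n"
  shows "(\<Sum>k<n. g k * (if j = k then 1 else 0)) = g j"
    and "(\<Sum>k<n. g k * (if k = j then 1 else 0)) = g j"
  using assms by (simp_all add: if_distrib[of "\<lambda>t. _ * t"] cong: if_cong)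

locale eigenbasis =
  fixes n :: nat and U :: "real mat" and b :: "nat \<Rightarrow> real Matrix.vec" and l :: "nat \<Rightarrow> real"
  assumes basis: "orthonormal_eigenbasis n U b l" and U_carrier: "U \<in> carrier_mat n n"
begin

lemma b_carrier [simp]: "j < n \<Longrightarrow> b j \<in> carrier_vec n"
  and b_dim [simp]: "j < n \<Longrightarrow> dim_vec (b j) = n"
  and eigen: "j < n \<Longrightarrow> U *\<^sub>v b j = l j \<cdot>\<^sub>v b j"
  using basis unfolding orthonormal_eigenbasis_def by auto

lemma b_orth: "i < n \<Longrightarrow> j < n \<Longrightarrow> (\<Sum>k<n. b i $ k * b j $ k) = (if i = j then 1 else 0)"
  using basis unfolding orthonormal_eigenbasis_def
  by (auto simp: scalar_prod_def lessThan_atLeast0)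

definition P :: "real mat" where "P = mat n n (\<lambda>(i, j). b j $ i)"

lemma P_carrier [simp]: "P \<in> carrier_mat n n"
  by (simp add: P_def)

lemma PT_P: "P\<^sup>T * P = 1\<^sub>m n"
  by (rule eq_matI) (auto simp: P_def scalar_prod_def lessThan_atLeast0[symmetric] b_orth)

lemma P_PT: "P * P\<^sup>T = 1\<^sub>m n"
  using mat_mult_left_right_inverse[OF _ P_carrier PT_P] by simp

text \<open>Orthonormal columns of the square matrix \<open>P\<close> make \<open>P\<^sup>T\<close>
  a left inverse, hence also a right inverse; read entrywise, this is the resolution of the identity
  by the basis.\<close>

lemma b_complete:
  assumes "i < n" "k < n"
  shows "(\<Sum>j<n. b j $ i * b j $ k) = (if i = k then 1 else 0)"
proof -
  have "(P * P\<^sup>T) $$ (i, k) = (1\<^sub>m n :: real mat) $$ (i, k)" by (simp add: P_PT)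
  then show ?thesis
    using assms by (simp add: P_def scalar_prod_def lessThan_atLeast0[symmetric])
qed

text \<open>Functional calculus of \<open>U\<close>: the matrix with eigenvalue \<open>d j\<close>
  on \<open>b j\<close>. The matrix \<open>Sigma_mat\<close>, its inverse, the posterior covariance
  and a root of it are all of this form, so matrix identities reduce to identities between the
  numbers \<open>d j\<close>.\<close>

definition S :: "(nat \<Rightarrow> real) \<Rightarrow> real mat" where
  "S d = mat n n (\<lambda>(i, k). \<Sum>j<n. d j * b j $ i * b j $ k)"

lemma S_carrier [simp]: "S d \<in> carrier_mat n n"
  by (simp add: S_def)

lemma S_cong: "(\<And>j. j < n \<Longrightarrow> d j = d' j) \<Longrightarrow> S d = S d'"
  unfolding S_def by (intro arg_cong[where f = "mat n n"] ext) (auto intro!: sum.cong)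

lemma S_one: "S (\<lambda>_. 1) = 1\<^sub>m n"
  by (rule eq_matI) (auto simp: S_def b_complete)

lemma S_mult: "S d * S d' = S (\<lambda>j. d j * d' j)"
proof (rule eq_matI)
  fix i h assume "i < dim_row (S (\<lambda>j. d j * d' j))" "h < dim_col (S (\<lambda>j. d j * d' j))"
  then have ih: "i < n" "h < n" by (auto simp: S_def)
  have "(S d * S d') $$ (i, h)
      = (\<Sum>k<n. (\<Sum>j<n. d j * b j $ i * b j $ k) * (\<Sum>j<n. d' j * b j $ k * b j $ h))"
    using ih by (simp add: S_def scalar_prod_def lessThan_atLeast0[symmetric])
  also have "\<dots> = (\<Sum>k<n. \<Sum>j<n. \<Sum>j'<n. d j * b j $ i * d' j' * b j' $ h * (b j $ k * b j' $ k))"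
    by (simp add: sum_product algebra_simps)
  also have "\<dots> = (\<Sum>j<n. \<Sum>j'<n. \<Sum>k<n. d j * b j $ i * d' j' * b j' $ h * (b j $ k * b j' $ k))"
    by (subst sum.swap, rule sum.cong[OF refl], rule sum.swap)
  also have "\<dots> = (\<Sum>j<n. \<Sum>j'<n. d j * b j $ i * d' j' * b j' $ h * (if j = j' then 1 else 0))"
    by (simp add: sum_distrib_left[symmetric] b_orth)
  also have "\<dots> = (\<Sum>j<n. d j * b j $ i * d' j * b j $ h)"
    by (rule sum.cong[OF refl], rule sum_prod_kronecker) simp
  also have "\<dots> = S (\<lambda>j. d j * d' j) $$ (i, h)"
    using ih by (simp add: S_def algebra_simps)
  finally show "(S d * S d') $$ (i, h) = S (\<lambda>j. d j * d' j) $$ (i, h)" .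
qed (auto simp: S_def)

lemma S_add: "S d + S d' = S (\<lambda>j. d j + d' j)"
  by (rule eq_matI) (auto simp: S_def algebra_simps sum.distrib)

lemma S_diff: "S d - S d' = S (\<lambda>j. d j - d' j)"
  by (rule eq_matI) (auto simp: S_def algebra_simps sum_subtractf)

lemma S_smult: "a \<cdot>\<^sub>m S d = S (\<lambda>j. a * d j)"
  by (rule eq_matI) (auto simp: S_def algebra_simps sum_distrib_left)

lemma S_transpose: "(S d)\<^sup>T = S d"
  by (rule eq_matI) (auto simp: S_def algebra_simps)

text \<open>The eigenvector equations determine \<open>U\<close> because \<open>b_complete\<close>
  allows the identity to be inserted as the sum of the projections onto the
  \<open>b j\<close>.\<close>

lemma U_eq_S: "U = S l"
proof (rule eq_matI)
  fix i h assume "i < dim_row (S l)" "h < dim_col (S l)"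
  then have ih: "i < n" "h < n" by (auto simp: S_def)
  have ev: "(\<Sum>k<n. U $$ (i, k) * b j $ k) = l j * b j $ i" if "j < n" for j
  proof -
    have "(U *\<^sub>v b j) $ i = (l j \<cdot>\<^sub>v b j) $ i" using that by (simp add: eigen)
    then show ?thesis
      using that ih U_carrier by (simp add: scalar_prod_def lessThan_atLeast0[symmetric])
  qed
  have "U $$ (i, h) = (\<Sum>k<n. U $$ (i, k) * (if k = h then 1 else 0))"
    using ih by (simp only: sum_prod_kronecker)
  also have "\<dots> = (\<Sum>k<n. U $$ (i, k) * (\<Sum>j<n. b j $ k * b j $ h))"
    using ih by (intro sum.cong) (auto simp: b_complete)
  also have "\<dots> = (\<Sum>k<n. \<Sum>j<n. U $$ (i, k) * b j $ k * b j $ h)"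
    by (simp add: sum_distrib_left algebra_simps)
  also have "\<dots> = (\<Sum>j<n. \<Sum>k<n. U $$ (i, k) * b j $ k * b j $ h)"
    by (rule sum.swap)
  also have "\<dots> = (\<Sum>j<n. l j * b j $ i * b j $ h)"
    by (simp add: sum_distrib_right[symmetric] ev)
  finally show "U $$ (i, h) = S l $$ (i, h)" using ih by (simp add: S_def)
qed (use U_carrier in \<open>auto simp: S_def\<close>)

lemma S_mult_coef:
  assumes y: "y \<in> carrier_vec n" and j: "j < n"
  shows "(S d *\<^sub>v y) \<bullet> b j = d j * (y \<bullet> b j)"
proof -
  have "(S d *\<^sub>v y) \<bullet> b j
      = (\<Sum>i<n. (\<Sum>k<n. (\<Sum>h<n. d h * b h $ i * b h $ k) * y $ k) * b j $ i)"
    using y j by (simp add: S_def scalar_prod_def lessThan_atLeast0[symmetric])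
  also have "\<dots> = (\<Sum>i<n. \<Sum>k<n. \<Sum>h<n. (d h * b h $ k * y $ k) * (b h $ i * b j $ i))"
    by (simp add: sum_distrib_left sum_distrib_right algebra_simps)
  also have "\<dots> = (\<Sum>k<n. \<Sum>i<n. \<Sum>h<n. (d h * b h $ k * y $ k) * (b h $ i * b j $ i))"
    by (rule sum.swap)
  also have "\<dots> = (\<Sum>k<n. \<Sum>h<n. \<Sum>i<n. (d h * b h $ k * y $ k) * (b h $ i * b j $ i))"
    by (rule sum.cong[OF refl], rule sum.swap)
  also have "\<dots> = (\<Sum>k<n. \<Sum>h<n. (d h * b h $ k * y $ k) * (if h = j then 1 else 0))"
    using j by (simp add: sum_distrib_left[symmetric] b_orth)
  also have "\<dots> = (\<Sum>k<n. d j * b j $ k * y $ k)"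
    by (rule sum.cong[OF refl], rule sum_prod_kronecker) (use j in simp)
  also have "\<dots> = d j * (y \<bullet> b j)"
    using y j by (simp add: scalar_prod_def lessThan_atLeast0[symmetric] sum_distrib_left algebra_simps)
  finally show ?thesis .
qed

lemma parseval:
  assumes "v \<in> carrier_vec n" "w \<in> carrier_vec n"
  shows "v \<bullet> w = (\<Sum>j<n. (v \<bullet> b j) * (w \<bullet> b j))"
proof -
  have "(\<Sum>j<n. (v \<bullet> b j) * (w \<bullet> b j))
      = (\<Sum>j<n. \<Sum>i<n. \<Sum>k<n. (v $ i * w $ k) * (b j $ i * b j $ k))"
    using assms
    by (intro sum.cong refl)
       (simp add: scalar_prod_def lessThan_atLeast0[symmetric] sum_product algebra_simps)
  also have "\<dots> = (\<Sum>i<n. \<Sum>j<n. \<Sum>k<n. (v $ i * w $ k) * (b j $ i * b j $ k))"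
    by (rule sum.swap)
  also have "\<dots> = (\<Sum>i<n. \<Sum>k<n. \<Sum>j<n. (v $ i * w $ k) * (b j $ i * b j $ k))"
    by (rule sum.cong[OF refl], rule sum.swap)
  also have "\<dots> = (\<Sum>i<n. \<Sum>k<n. (v $ i * w $ k) * (if i = k then 1 else 0))"
    by (simp add: sum_distrib_left[symmetric] b_complete)
  also have "\<dots> = (\<Sum>i<n. v $ i * w $ i)"
    by (rule sum.cong[OF refl], rule sum_prod_kronecker) simp
  finally show ?thesis
    using assms by (simp add: scalar_prod_def lessThan_atLeast0[symmetric])
qed

lemma vnorm_square:
  assumes "v \<in> carrier_vec n"
  shows "(vnorm v)\<^sup>2 = (\<Sum>j<n. (v \<bullet> b j)\<^sup>2)"
  unfolding vnorm_def parseval[OF assms assms]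
  by (subst real_sqrt_pow2) (auto intro!: sum_nonneg simp: power2_eq_square)

text \<open>Uses the factorization of \<open>S d\<close> into \<open>P\<close>, a diagonal matrix
  and \<open>P\<^sup>T\<close>; the determinants of the two orthogonal factors multiply to
  1.\<close>

lemma det_S: "Determinant.det (S d) = (\<Prod>j<n. d j)"
proof -
  let ?D = "mat n n (\<lambda>(i, j). if i = j then d j else 0)"
  have PD: "P * ?D = mat n n (\<lambda>(i, j). d j * b j $ i)"
  proof (rule eq_matI, goal_cases)
    case (1 i j)
    then have ij: "i < n" "j < n" by auto
    have "(P * ?D) $$ (i, j) = (\<Sum>k<n. b k $ i * (if k = j then d j else 0))"
      using ij by (simp add: P_def scalar_prod_def lessThan_atLeast0[symmetric])
    also have "\<dots> = (\<Sum>k<n. (d j * b k $ i) * (if k = j then 1 else 0))"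
      by (intro sum.cong) auto
    also have "\<dots> = d j * b j $ i" by (rule sum_prod_kronecker) (use ij in simp)
    finally show ?case using ij by simp
  qed (auto simp: P_def)
  have SP: "S d = P * ?D * P\<^sup>T"
    unfolding PD
    by (rule eq_matI) (auto simp: S_def P_def scalar_prod_def lessThan_atLeast0[symmetric])
  have "Determinant.det ?D = (\<Prod>j<n. d j)"
    by (subst det_upper_triangular[of _ n])
       (auto simp: upper_triangular_def diag_mat_def lessThan_atLeast0
             prod.distinct_set_conv_list[symmetric] intro!: prod.cong)
  moreover have "Determinant.det P * Determinant.det (P\<^sup>T) = 1"
    using det_mult[OF P_carrier transpose_carrier_mat[THEN iffD2, OF P_carrier]] 
    by (simp add: P_PT)
  moreover have "Determinant.det (S d)
      = Determinant.det P * Determinant.det ?D * Determinant.det (P\<^sup>T)"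
    unfolding SP
    using det_mult[of "P * ?D" n "P\<^sup>T"] det_mult[OF P_carrier, of ?D] by (simp add: PD)
  ultimately show ?thesis by (simp add: mult.commute mult.left_commute)
qed

text \<open>\<open>mat_inv\<close> takes \<open>the\<close> of an option, so the case
  \<open>None\<close> has to be refuted by exhibiting an inverse; in the case \<open>Some\<close>,
  uniqueness of inverses identifies the result.\<close>

lemma mat_inv_S:
  assumes "\<And>j. j < n \<Longrightarrow> d j \<noteq> 0"
  shows "mat_inv (S d) = S (\<lambda>j. 1 / d j)"
proof -
  have I: "S (\<lambda>j. 1 / d j) * S d = 1\<^sub>m n" "S d * S (\<lambda>j. 1 / d j) = 1\<^sub>m n"
    unfolding S_mult S_one[symmetric] using assms by (auto intro!: S_cong)
  show ?thesis
  proof (cases "mat_inverse (S d)")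
    case None
    have "S d \<in> Units (ring_mat TYPE(real) n n)"
      using I unfolding Units_def by (auto simp: ring_mat_def intro!: bexI[of _ "S (\<lambda>j. 1 / d j)"])
    with mat_inverse(1)[OF S_carrier None, of n] show ?thesis by simp
  next
    case (Some B)
    then have B: "B * S d = 1\<^sub>m n" "B \<in> carrier_mat n n"
      using mat_inverse(2)[OF S_carrier Some] by auto
    have "B = B * (S d * S (\<lambda>j. 1 / d j))" using B I by simp
    also have "\<dots> = (B * S d) * S (\<lambda>j. 1 / d j)"
      by (rule assoc_mult_mat[symmetric, of _ n n _ n _ n]) (use B in auto)
    also have "\<dots> = S (\<lambda>j. 1 / d j)" using B left_mult_one_mat[OF S_carrier] by simp
    finally show ?thesis using Some by (simp add: mat_inv_def)
  qed
qed

lemma Sigma_eq_S: "Sigma_mat n U c = S (\<lambda>j. 1 + c * l j)"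
  unfolding Sigma_mat_def by (subst U_eq_S) (simp add: S_smult S_one[symmetric] S_add)

lemma det_Sigma: "Determinant.det (Sigma_mat n U c) = (\<Prod>j<n. 1 + c * l j)"
  by (simp add: Sigma_eq_S det_S)

context
  fixes c :: real
  assumes c: "c \<ge> 0" and l_nonneg: "\<And>j. j < n \<Longrightarrow> l j \<ge> 0"
begin

lemma one_plus_pos: "j < n \<Longrightarrow> 1 + c * l j > 0"
  using c l_nonneg[of j] mult_nonneg_nonneg[of c "l j"] by linarith

lemma inv_Sigma: "mat_inv (Sigma_mat n U c) = S (\<lambda>j. 1 / (1 + c * l j))"
  unfolding Sigma_eq_S by (rule mat_inv_S) (use one_plus_pos in force)

lemma posterior_cov: "1\<^sub>m n - mat_inv (Sigma_mat n U c) = S (\<lambda>j. c * l j / (1 + c * l j))"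
  unfolding inv_Sigma S_one[symmetric] S_diff
  by (rule S_cong) (use one_plus_pos in \<open>force simp: field_simps\<close>)

lemma quadratic_form:
  assumes "y \<in> carrier_vec n"
  shows "y \<bullet> (mat_inv (Sigma_mat n U c) *\<^sub>v y) = (\<Sum>j<n. (y \<bullet> b j)\<^sup>2 / (1 + c * l j))"
  unfolding inv_Sigma
  by (subst parseval[OF assms])
     (use assms in \<open>auto simp: S_mult_coef power2_eq_square intro!: mult_mat_vec_carrier[OF S_carrier]\<close>)

lemma fhat_coef:
  assumes "y \<in> carrier_vec n" "j < n"
  shows "fhat n U c y \<bullet> b j = c * l j / (1 + c * l j) * (y \<bullet> b j)"
  unfolding fhat_def posterior_cov by (rule S_mult_coef[OF assms])

lemma fhat_carrier: "fhat n U c y \<in> carrier_vec n"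
  unfolding fhat_def posterior_cov carrier_vec_def by (simp add: S_def)

text \<open>The symmetric root, diagonal in the eigenbasis, shows that the choice of
  \<open>B\<close> in \<open>gaussian_law\<close> is not vacuous.\<close>

lemma ex_cov_root: "\<exists>B. B \<in> carrier_mat n n \<and> B * B\<^sup>T = 1\<^sub>m n - mat_inv (Sigma_mat n U c)"
proof (intro exI conjI)
  let ?B = "S (\<lambda>j. sqrt (c * l j / (1 + c * l j)))"
  show "?B \<in> carrier_mat n n" by simp
  show "?B * ?B\<^sup>T = 1\<^sub>m n - mat_inv (Sigma_mat n U c)"
    unfolding S_transpose S_mult posterior_cov
    using c l_nonneg by (intro S_cong) auto
qed

text \<open>Stated for every root because \<open>gaussian_law\<close> picks an arbitrary one. The
  squared Frobenius norm is the trace of \<open>B * B\<^sup>T\<close>, the sum of the eigenvalues;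
  later this is \<open>s2\<close>.\<close>

lemma trace_cov_root:
  assumes B: "B \<in> carrier_mat n n" "B * B\<^sup>T = 1\<^sub>m n - mat_inv (Sigma_mat n U c)"
  shows "(\<Sum>i<n. \<Sum>k<n. (B $$ (i, k))\<^sup>2) = (\<Sum>j<n. c * l j / (1 + c * l j))"
proof -
  have "(\<Sum>k<n. (B $$ (i, k))\<^sup>2) = S (\<lambda>j. c * l j / (1 + c * l j)) $$ (i, i)" if "i < n" for i
    using that B(1) unfolding posterior_cov[symmetric] B(2)[symmetric]
    by (simp add: scalar_prod_def lessThan_atLeast0[symmetric] power2_eq_square)
  then have "(\<Sum>i<n. \<Sum>k<n. (B $$ (i, k))\<^sup>2)
      = (\<Sum>i<n. \<Sum>j<n. c * l j / (1 + c * l j) * (b j $ i * b j $ i))"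
    by (simp add: S_def algebra_simps cong: sum.cong_simp)
  also have "\<dots> = (\<Sum>j<n. \<Sum>i<n. c * l j / (1 + c * l j) * (b j $ i * b j $ i))"
    by (rule sum.swap)
  also have "\<dots> = (\<Sum>j<n. c * l j / (1 + c * l j))"
    by (rule sum.cong[OF refl], subst sum_distrib_left[symmetric]) (simp add: b_orth)
  finally show ?thesis .
qed

end

end

section \<open>Nonnegative eigenvalues of the covariance matrix\<close>

lemma square_integrable_mult:
  fixes f g :: "'a \<Rightarrow> real"
  assumes "f \<in> borel_measurable M" "g \<in> borel_measurable M"
    "integrable M (\<lambda>x. (f x)\<^sup>2)" "integrable M (\<lambda>x. (g x)\<^sup>2)"
  shows "integrable M (\<lambda>x. f x * g x)"
proof (rule Bochner_Integration.integrable_bound)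
  show "integrable M (\<lambda>x. (f x)\<^sup>2 + (g x)\<^sup>2)" using assms by simp
  show "AE x in M. norm (f x * g x) \<le> norm ((f x)\<^sup>2 + (g x)\<^sup>2)"
  proof (rule AE_I2)
    fix x
    have "2 * (\<bar>f x\<bar> * \<bar>g x\<bar>) \<le> (f x)\<^sup>2 + (g x)\<^sup>2"
      using sum_squares_bound[of "\<bar>f x\<bar>" "\<bar>g x\<bar>"] by simp
    then show "norm (f x * g x) \<le> norm ((f x)\<^sup>2 + (g x)\<^sup>2)"
      using mult_nonneg_nonneg[OF abs_ge_zero abs_ge_zero, of "f x" "g x"]
      by (simp only: abs_mult real_norm_def)
  qed
qed (use assms in measurable)

lemma gaussian_process_square_integrable:
  assumes "centred_gaussian_process \<Omega> W"
  shows "integrable \<Omega> (\<lambda>\<omega>. (W t \<omega>)\<^sup>2)"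
proof -
  interpret prob_space \<Omega> using assms by (simp add: centred_gaussian_process_def)
  have meas [measurable]: "W t \<in> borel_measurable \<Omega>"
    using assms by (simp add: centred_gaussian_process_def)
  have "centred_normal (distr \<Omega> borel (\<lambda>\<omega>. \<Sum>s\<in>{t}. 1 * W s \<omega>))"
    using assms unfolding centred_gaussian_process_def
    by (elim conjE allE[of _ "{t}"] allE[of _ "\<lambda>_. 1"]) simp
  then have N: "centred_normal (distr \<Omega> borel (W t))" by simp
  have "integrable (distr \<Omega> borel (W t)) (\<lambda>z. z\<^sup>2)"
    using N unfolding centred_normal_def
  proof (elim disjE exE conjE)
    assume "distr \<Omega> borel (W t) = return borel 0"
    then show ?thesis by (auto intro!: integrableI_bounded simp: nn_integral_return)
  next
    fix \<sigma> :: real assume "\<sigma> > 0" and eq: "distr \<Omega> borel (W t) = density lborel (normal_density 0 \<sigma>)"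
    then show ?thesis
      using integrable_normal_moment[of \<sigma> 0 2] by (simp add: integrable_density)
  qed
  then show ?thesis by (subst (asm) integrable_distr_eq) auto
qed

text \<open>The eigenvalue is the quadratic form of the covariance at the unit vector
  \<open>b j\<close>, hence the second moment of one linear combination of process values. Square
  integrability of \<open>W\<close> permits exchanging sum and integral.\<close>

lemma eigenvalue_nonneg:
  assumes W: "centred_gaussian_process \<Omega> W"
    and e: "orthonormal_eigenbasis n (cov_mat \<Omega> W x n) b l" and j: "j < n"
  shows "l j \<ge> 0"
proof -
  interpret eigenbasis n "cov_mat \<Omega> W x n" b l
    by standard (use e in \<open>auto simp: cov_mat_def\<close>)
  have int: "integrable \<Omega> (\<lambda>\<omega>. W s \<omega> * W t \<omega>)" for s t
    using W gaussian_process_square_integrable[OF W]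
    by (intro square_integrable_mult) (auto simp: centred_gaussian_process_def)
  have "l j = b j \<bullet> (cov_mat \<Omega> W x n *\<^sub>v b j)"
    using j basis by (simp add: eigen orthonormal_eigenbasis_def)
  also have "\<dots> = (\<Sum>i<n. \<Sum>k<n. b j $ i * b j $ k * (LINT \<omega>|\<Omega>. W (x n i) \<omega> * W (x n k) \<omega>))"
    using j by (simp add: cov_mat_def scalar_prod_def lessThan_atLeast0[symmetric]
        sum_distrib_left algebra_simps)
  also have "\<dots> = (LINT \<omega>|\<Omega>. (\<Sum>i<n. \<Sum>k<n. b j $ i * b j $ k * (W (x n i) \<omega> * W (x n k) \<omega>)))"
    using int by (simp add: Bochner_Integration.integral_sum)
  also have "\<dots> = (LINT \<omega>|\<Omega>. (\<Sum>i<n. b j $ i * W (x n i) \<omega>)\<^sup>2)"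
    by (simp add: power2_eq_square sum_product algebra_simps)
  also have "\<dots> \<ge> 0" by simp
  finally show ?thesis .
qed

section \<open>Standard Gaussian vectors: moments, null sets, support\<close>

abbreviation std_normal :: "real measure" where
  "std_normal \<equiv> density lborel std_normal_density"

lemma prob_space_std_normal: "prob_space std_normal"
  by (rule prob_space_normal_density) simp

lemma space_std_gaussian: "space (std_gaussian n) = {..<n} \<rightarrow>\<^sub>E UNIV"
  unfolding std_gaussian_def by (simp add: space_PiM)

lemma measurable_std_gaussian_component [measurable]:
  "i < n \<Longrightarrow> (\<lambda>\<xi>. \<xi> i) \<in> borel_measurable (std_gaussian n)"
  unfolding std_gaussian_def by (rule measurable_component_singleton[where M = "\<lambda>_. std_normal", simplified]) simp

lemma product_prob_space_std_normal: "product_prob_space (\<lambda>_::nat. std_normal)"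
  by (intro product_prob_spaceI prob_space_std_normal)

lemma prob_space_std_gaussian: "prob_space (std_gaussian n)"
  unfolding std_gaussian_def by (rule prob_space_PiM) (rule prob_space_std_normal)

lemma std_normal_moments:
  shows "integrable std_normal (\<lambda>t. t)" "integrable std_normal (\<lambda>t. t\<^sup>2)"
    "(LINT t|std_normal. t) = 0" "(LINT t|std_normal. t\<^sup>2) = 1"
  using std_normal_moment_odd[of 0] std_normal_moment_even[of 1]
  by (simp_all add: integrable_density integral_density has_bochner_integral_iff)

lemma std_gaussian_covariance:
  assumes i: "i < n" and k: "k < n"
  shows "integrable (std_gaussian n) (\<lambda>\<xi>. \<xi> i * \<xi> k)"
    and "(LINT \<xi>|std_gaussian n. \<xi> i * \<xi> k) = (if i = k then 1 else 0)"
proof -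
  interpret product_prob_space "\<lambda>_::nat. std_normal" by (rule product_prob_space_std_normal)
  \<comment> \<open>The factor contributed by coordinate \<open>j\<close>, so that the second moment
    becomes a product of one-dimensional moments; for \<open>i = k\<close> the factor at
    \<open>i\<close> is the square.\<close>
  define f :: "nat \<Rightarrow> real \<Rightarrow> real" where
    "f j t = (if j = i then t else 1) * (if j = k then t else 1)" for j t
  have f: "f j = (if j = i \<and> j = k then (\<lambda>t. t\<^sup>2) else if j = i \<or> j = k then (\<lambda>t. t) else (\<lambda>t. 1))" for j
    by (auto simp: f_def fun_eq_iff power2_eq_square)
  have int: "integrable std_normal (f j)" for j
    unfolding f using std_normal_moments by auto
  have prod: "(\<Prod>j<n. f j (\<xi> j)) = \<xi> i * \<xi> k" for \<xi>
    unfolding f_def prod.distrib using i k by simp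
  show "integrable (std_gaussian n) (\<lambda>\<xi>. \<xi> i * \<xi> k)"
    using product_integrable_prod[of "{..<n}" f] int unfolding prod std_gaussian_def by simp
  have "(LINT \<xi>|std_gaussian n. \<xi> i * \<xi> k) = (\<Prod>j<n. LINT t|std_normal. f j t)"
    using product_integral_prod[of "{..<n}" f] int unfolding prod std_gaussian_def by simp
  also have "\<dots> = (if i = k then 1 else 0)"
  proof (cases "i = k")
    case True
    then have "(LINT t|std_normal. f j t) = 1" for j
      unfolding f using std_normal_moments prob_space.prob_space[OF prob_space_std_normal] by simp
    with True show ?thesis by simp
  next
    case False
    then have "(LINT t|std_normal. f i t) = 0"
      unfolding f using std_normal_moments by simp
    with False i show ?thesis by auto
  qed
  finally show "(LINT \<xi>|std_gaussian n. \<xi> i * \<xi> k) = (if i = k then 1 else 0)" .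
qed

lemma emeasure_std_normal_finite: 
  assumes "finite A" shows "emeasure std_normal A = 0"
proof -
  have A: "A \<in> sets lborel" using assms by (simp add: finite_imp_closed)
  have "AE x in lborel. x \<notin> A"
    using assms by (intro AE_not_in) (auto simp: null_sets_def finite_imp_closed emeasure_lborel_countable countable_finite)
  then show ?thesis
    using A by (auto simp: emeasure_density nn_integral_0_iff_AE)
qed

lemma emeasure_std_normal_open:
  assumes "open X" "X \<noteq> {}" shows "emeasure std_normal X > 0"
proof -
  obtain x d where d: "d > 0" "ball x d \<subseteq> X" using assms open_contains_ball by blast
  have "\<not> emeasure std_normal X = 0"
  proof
    assume "emeasure std_normal X = 0"
    then have "AE t in lborel. ennreal (std_normal_density t) * indicator X t = 0"
      using assms by (simp add: emeasure_density nn_integral_0_iff_AE)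
    then have "AE t in lborel. t \<notin> {x - d <..< x + d}"
    proof (rule AE_mp, intro AE_I2 impI)
      fix t assume "ennreal (std_normal_density t) * indicator X t = 0"
      then have "t \<notin> X" using normal_density_pos[of 1 0 t] by (auto split: split_indicator_asm)
      then show "t \<notin> {x - d <..< x + d}" using d by (auto simp: dist_real_def subset_iff)
    qed
    then have "emeasure lborel {x - d <..< x + d} = 0"
      using AE_iff_null_sets[of "{x - d <..< x + d}" lborel] by (simp add: null_sets_def)
    then show False using d by simp
  qed
  then show ?thesis by (simp add: zero_less_iff_neq_zero)
qed

section \<open>Length of a Gaussian vector and the radius of the ball\<close>

text \<open>The squared length of \<open>B\<close> applied to \<open>\<xi>\<close>. For
  \<open>B\<close> a root of the posterior covariance its law decides the ball probabilities in
  \<open>radius\<close>.\<close>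

definition sq_length :: "nat \<Rightarrow> real mat \<Rightarrow> (nat \<Rightarrow> real) \<Rightarrow> real" where
  "sq_length n B \<xi> = (\<Sum>i<n. (\<Sum>k<n. B $$ (i, k) * \<xi> k)\<^sup>2)"

lemma sq_length_nonneg: "sq_length n B \<xi> \<ge> 0"
  unfolding sq_length_def by (rule sum_nonneg) simp

lemma sqrt_sq_length_less_iff:
  "0 \<le> r \<Longrightarrow> sqrt (sq_length n B \<xi>) < r \<longleftrightarrow> sq_length n B \<xi> < r\<^sup>2"
  using real_sqrt_less_iff[of "sq_length n B \<xi>" "r\<^sup>2"] by simp

lemma sqrt_sq_length_not_less: "r \<le> 0 \<Longrightarrow> \<not> sqrt (sq_length n B \<xi>) < r"
  using real_sqrt_ge_zero[OF sq_length_nonneg, of n B \<xi>] by linarith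

lemma measurable_sq_length [measurable]: "sq_length n B \<in> borel_measurable (std_gaussian n)"
  unfolding sq_length_def by measurable

lemma sq_length_expectation:
  shows "integrable (std_gaussian n) (sq_length n B)"
    and "(LINT \<xi>|std_gaussian n. sq_length n B \<xi>) = (\<Sum>i<n. \<Sum>k<n. (B $$ (i, k))\<^sup>2)"
proof -
  have eq: "sq_length n B = (\<lambda>\<xi>. \<Sum>i<n. \<Sum>k<n. \<Sum>h<n. B $$ (i, k) * B $$ (i, h) * (\<xi> k * \<xi> h))"
    unfolding sq_length_def by (simp add: fun_eq_iff power2_eq_square sum_product algebra_simps)
  have "has_bochner_integral (std_gaussian n) (sq_length n B)
      (\<Sum>i<n. \<Sum>k<n. \<Sum>h<n. B $$ (i, k) * B $$ (i, h) * (if k = h then 1 else 0))"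
    unfolding eq
    by (intro has_bochner_integral_sum has_bochner_integral_mult_right)
       (auto simp: has_bochner_integral_iff std_gaussian_covariance)
  moreover have "(\<Sum>h<n. B $$ (i, k) * B $$ (i, h) * (if k = h then 1 else 0)) = (B $$ (i, k))\<^sup>2"
    if "k < n" for i k
    using that by (simp add: if_distrib[of "\<lambda>t. _ * t"] power2_eq_square cong: if_cong)
  ultimately have "has_bochner_integral (std_gaussian n) (sq_length n B) (\<Sum>i<n. \<Sum>k<n. (B $$ (i, k))\<^sup>2)"
    by simp
  then show "integrable (std_gaussian n) (sq_length n B)"
    and "(LINT \<xi>|std_gaussian n. sq_length n B \<xi>) = (\<Sum>i<n. \<Sum>k<n. (B $$ (i, k))\<^sup>2)"
    by (simp_all add: has_bochner_integral_iff)
qed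

text \<open>The leading coefficient is made explicit because it is the squared norm of column
  \<open>k\<close>, positive as soon as one entry of that column is nonzero; the absence of atoms
  rests on this.\<close>

lemma sq_length_upd:
  assumes k: "k < n"
  obtains \<beta> \<gamma> where "\<And>t. sq_length n B (\<xi>(k := t)) = (\<Sum>i<n. (B $$ (i, k))\<^sup>2) * t\<^sup>2 + \<beta> * t + \<gamma>"
proof -
  define r where "r i = (\<Sum>h\<in>{..<n} - {k}. B $$ (i, h) * \<xi> h)" for i
  have "(\<Sum>h<n. B $$ (i, h) * (\<xi>(k := t)) h) = B $$ (i, k) * t + r i" for i t
    using k by (subst sum.remove[of _ k]) (auto simp: r_def intro!: sum.cong)
  then have "sq_length n B (\<xi>(k := t))
      = (\<Sum>i<n. (B $$ (i, k))\<^sup>2) * t\<^sup>2 + (\<Sum>i<n. 2 * B $$ (i, k) * r i) * t + (\<Sum>i<n. (r i)\<^sup>2)" for t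
    unfolding sq_length_def
    by (simp add: sum.distrib power2_eq_square sum_distrib_left sum_distrib_right algebra_simps)
  then show ?thesis by (rule that)
qed

lemma column_pos:
  assumes "i < n" "B $$ (i, k) \<noteq> (0 :: real)"
  shows "(\<Sum>i<n. (B $$ (i, k))\<^sup>2) > 0"
  using assms by (intro sum_pos2[of _ i]) auto

text \<open>Fubini in coordinate \<open>k\<close>: with the other coordinates fixed, the level set
  lies in the zero set of a nonzero quadratic polynomial, which is finite and therefore
  null.\<close>

lemma sq_length_no_atoms:
  assumes i: "i < n" and k: "k < n" and B: "B $$ (i, k) \<noteq> 0"
  shows "measure (std_gaussian n) {\<xi> \<in> space (std_gaussian n). sq_length n B \<xi> = s} = 0"
proof -
  interpret product_prob_space "\<lambda>_::nat. std_normal" by (rule product_prob_space_std_normal)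
  let ?J = "{..<n} - {k}"
  let ?A = "{\<xi> \<in> space (std_gaussian n). sq_length n B \<xi> = s}"
  have ins: "insert k ?J = {..<n}" using k by auto
  have A [measurable]: "?A \<in> sets (std_gaussian n)" by measurable
  have meas: "(\<lambda>\<xi>. indicator ?A \<xi> :: ennreal) \<in> borel_measurable (PiM (insert k ?J) (\<lambda>_. std_normal))"
    unfolding ins std_gaussian_def[symmetric] by measurable
  have "emeasure (std_gaussian n) ?A = (\<integral>\<^sup>+\<xi>. indicator ?A \<xi> \<partial>PiM (insert k ?J) (\<lambda>_. std_normal))"
    unfolding ins std_gaussian_def[symmetric] by simp
  also have "\<dots> = (\<integral>\<^sup>+y. (\<integral>\<^sup>+t. indicator ?A (y(k := t)) \<partial>std_normal) \<partial>PiM ?J (\<lambda>_. std_normal))"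
    by (rule product_nn_integral_insert[OF _ _ meas]) auto
  also have "\<dots> = (\<integral>\<^sup>+y. 0 \<partial>PiM ?J (\<lambda>_. std_normal))"
  proof (rule nn_integral_cong)
    fix y
    obtain \<beta> \<gamma> where q: "sq_length n B (y(k := t)) = (\<Sum>i<n. (B $$ (i, k))\<^sup>2) * t\<^sup>2 + \<beta> * t + \<gamma>" for t
      using sq_length_upd[OF k] by metis
    define p where "p = [:\<gamma> - s, \<beta>, (\<Sum>i<n. (B $$ (i, k))\<^sup>2):]"
    have "p \<noteq> 0" using column_pos[OF i B] by (auto simp: p_def)
    then have fin: "finite {t. poly p t = 0}" by (rule poly_roots_finite)
    have "(\<integral>\<^sup>+t. indicator ?A (y(k := t)) \<partial>std_normal) \<le> (\<integral>\<^sup>+t. indicator {t. poly p t = 0} t \<partial>std_normal)"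
      by (intro nn_integral_mono) (auto simp: q p_def power2_eq_square algebra_simps split: split_indicator)
    also have "\<dots> = emeasure std_normal {t. poly p t = 0}"
      using fin by (intro nn_integral_indicator) (simp add: finite_imp_closed)
    finally show "(\<integral>\<^sup>+t. indicator ?A (y(k := t)) \<partial>std_normal) = 0"
      using emeasure_std_normal_finite[OF fin] by simp
  qed
  finally show ?thesis by (simp add: measure_def)
qed

lemma continuous_sum_coords:
  fixes a :: "nat \<Rightarrow> real"
  shows "continuous_on UNIV (\<lambda>\<xi>. \<Sum>k<n. a k * \<xi> k)"
  by (intro continuous_intros continuous_on_product_coordinates)

lemma sq_length_continuous: "continuous_on UNIV (sq_length n B)"
  unfolding sq_length_def by (intro continuous_intros continuous_sum_coords)

text \<open>\<open>sq_length\<close> is continuous and takes the value \<open>(s + t) / 2\<close>,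
  so the event contains a product of nonempty open sets, each of positive normal measure. This makes
  the distribution of the length strictly increasing.\<close>

lemma sq_length_full_support:
  assumes i: "i < n" and k: "k < n" and B: "B $$ (i, k) \<noteq> 0" and st: "0 \<le> s" "s < t"
  shows "measure (std_gaussian n) {\<xi> \<in> space (std_gaussian n). s < sq_length n B \<xi> \<and> sq_length n B \<xi> < t} > 0"
proof -
  interpret product_prob_space "\<lambda>_::nat. std_normal" by (rule product_prob_space_std_normal)
  interpret G: prob_space "std_gaussian n" by (rule prob_space_std_gaussian)
  define \<alpha> where "\<alpha> = (\<Sum>i<n. (B $$ (i, k))\<^sup>2)"
  have \<alpha>: "\<alpha> > 0" unfolding \<alpha>_def by (rule column_pos[OF i B])
  \<comment> \<open>On the axis of coordinate \<open>k\<close> the form is \<open>\<alpha>\<close>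
    times the square of the coordinate; this point is sent to the middle of the target
    interval.\<close>
  define x0 :: "nat \<Rightarrow> real" where "x0 = (\<lambda>_. 0)(k := sqrt ((s + t) / 2 / \<alpha>))"
  have "(\<Sum>h<n. B $$ (j, h) * x0 h) = B $$ (j, k) * sqrt ((s + t) / 2 / \<alpha>)" for j
    unfolding x0_def using k by (subst sum.remove[of _ k]) auto
  then have "sq_length n B x0 = \<alpha> * (sqrt ((s + t) / 2 / \<alpha>))\<^sup>2"
    unfolding sq_length_def \<alpha>_def by (simp add: power_mult_distrib sum_distrib_right)
  then have "sq_length n B x0 = (s + t) / 2" using \<alpha> st by simp
  then have x0: "x0 \<in> sq_length n B -` {s<..<t}" using st by simp
  have "open (sq_length n B -` {s<..<t})"
    using sq_length_continuous by (intro open_vimage) auto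
  then have "openin (product_topology (\<lambda>_. euclidean) UNIV) (sq_length n B -` {s<..<t})"
    by (simp add: open_fun_def)
  then obtain X where X: "x0 \<in> (\<Pi>\<^sub>E i\<in>UNIV. X i)" "\<forall>i. openin euclidean (X i)"
      "(\<Pi>\<^sub>E i\<in>UNIV. X i) \<subseteq> sq_length n B -` {s<..<t}"
    using product_topology_open_contains_basis[OF _ x0] by metis
  from X(2) have X_open: "open (X i)" for i by simp
  have sub: "(\<Pi>\<^sub>E i\<in>{..<n}. X i) \<subseteq> {\<xi> \<in> space (std_gaussian n). s < sq_length n B \<xi> \<and> sq_length n B \<xi> < t}"
  proof
    fix \<xi> assume \<xi>: "\<xi> \<in> (\<Pi>\<^sub>E i\<in>{..<n}. X i)"
    \<comment> \<open>Noise in \<open>std_gaussian n\<close> is \<open>undefined\<close> beyond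
      \<open>n\<close>, where it could leave the box; the tail of \<open>x0\<close> lies in the box
      and is invisible to \<open>sq_length\<close>.\<close>
    let ?\<xi> = "\<lambda>i. if i < n then \<xi> i else x0 i"
    have "?\<xi> \<in> (\<Pi>\<^sub>E i\<in>UNIV. X i)" using \<xi> X(1) by (auto simp: PiE_iff)
    then have "?\<xi> \<in> sq_length n B -` {s<..<t}" using X(3) by blast
    moreover have "sq_length n B ?\<xi> = sq_length n B \<xi>"
      unfolding sq_length_def by (intro sum.cong refl arg_cong[where f = "\<lambda>u. u\<^sup>2"]) auto
    ultimately show "\<xi> \<in> {\<xi> \<in> space (std_gaussian n). s < sq_length n B \<xi> \<and> sq_length n B \<xi> < t}"
      using \<xi> by (auto simp: space_std_gaussian PiE_iff)
  qed
  have "emeasure (std_gaussian n) (\<Pi>\<^sub>E i\<in>{..<n}. X i) = (\<Prod>i<n. emeasure std_normal (X i))"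
    unfolding std_gaussian_def using X_open by (intro emeasure_PiM) auto
  also have "\<dots> \<noteq> 0"
  proof -
    have "X i \<noteq> {}" for i using X(1) by (auto simp: PiE_iff)
    then have "emeasure std_normal (X i) > 0" for i
      using emeasure_std_normal_open[OF X_open] by blast
    then show ?thesis by (simp add: less_le)
  qed
  finally have "measure (std_gaussian n) (\<Pi>\<^sub>E i\<in>{..<n}. X i) > 0"
    by (simp add: G.emeasure_eq_measure zero_less_measure_iff)
  also have "measure (std_gaussian n) (\<Pi>\<^sub>E i\<in>{..<n}. X i)
      \<le> measure (std_gaussian n) {\<xi> \<in> space (std_gaussian n). s < sq_length n B \<xi> \<and> sq_length n B \<xi> < t}"
    by (rule G.finite_measure_mono[OF sub]) measurable
  finally show ?thesis .
qed

text \<open>Supplies the unique existence behind \<open>THE\<close> in \<open>radius\<close>.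
  Existence is the intermediate value theorem, as there are no atoms; uniqueness is strict
  monotonicity for \<open>r \<ge> 0\<close>, and for \<open>r \<le> 0\<close> the probability is
  0.\<close>

lemma ex1_sq_length_quantile:
  assumes i: "i < n" and k: "k < n" and B: "B $$ (i, k) \<noteq> 0" and \<eta>: "0 < \<eta>" "\<eta> < 1"
  shows "\<exists>!r. measure (std_gaussian n) {\<xi> \<in> space (std_gaussian n). sqrt (sq_length n B \<xi>) < r} = \<eta>"
    (is "\<exists>!r. ?H r = \<eta>")
proof -
  interpret G: prob_space "std_gaussian n" by (rule prob_space_std_gaussian)
  define \<nu> where "\<nu> = distr (std_gaussian n) borel (\<lambda>\<xi>. sqrt (sq_length n B \<xi>))"
  interpret \<nu>: real_distribution \<nu>
    unfolding \<nu>_def by (rule G.real_distribution_distr) measurable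
  have \<nu>: "measure \<nu> A = measure (std_gaussian n) {\<xi> \<in> space (std_gaussian n). sqrt (sq_length n B \<xi>) \<in> A}"
    if "A \<in> sets borel" for A
    unfolding \<nu>_def using that by (subst measure_distr) (auto intro!: arg_cong[where f = "measure _"])
  have atom: "measure \<nu> {r} = 0" for r
  proof -
    have "measure \<nu> {r} \<le> measure (std_gaussian n) {\<xi> \<in> space (std_gaussian n). sq_length n B \<xi> = r\<^sup>2}"
      by (subst \<nu>, simp, rule G.finite_measure_mono) (auto simp: sq_length_nonneg)
    also have "\<dots> = 0" by (rule sq_length_no_atoms[OF i k B])
    finally show ?thesis using measure_nonneg[of \<nu> "{r}"] by linarith
  qed
  \<comment> \<open>The ball is open while \<open>cdf\<close> includes the endpoint; without atoms
    the two agree.\<close>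
  have H: "?H r = cdf \<nu> r" for r
  proof -
    have "cdf \<nu> r = measure \<nu> ({..<r} \<union> {r})" by (simp only: cdf_def ivl_disj_un_singleton(2))
    also have "\<dots> = measure \<nu> {..<r} + measure \<nu> {r}"
      by (rule \<nu>.finite_measure_Union) auto
    also have "\<dots> = ?H r" by (simp add: atom \<nu>)
    finally show ?thesis by simp
  qed
  have "eventually (\<lambda>r. cdf \<nu> r > \<eta>) at_top"
    by (rule order_tendstoD(1)[OF \<nu>.cdf_lim_at_top_prob \<eta>(2)])
  then obtain R0 where "\<And>r. r \<ge> R0 \<Longrightarrow> cdf \<nu> r > \<eta>"
    by (auto simp: eventually_at_top_linorder)
  then obtain R where R: "cdf \<nu> R > \<eta>" "R \<ge> 0"
    by (meson max.cobounded1 max.cobounded2)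
  have neg: "?H r = 0" if "r \<le> 0" for r
  proof -
    have "{\<xi> \<in> space (std_gaussian n). sqrt (sq_length n B \<xi>) < r} = {}"
      using sqrt_sq_length_not_less[OF that] by blast
    then show ?thesis by (metis measure_empty)
  qed
  have "cdf \<nu> 0 = 0" using neg[of 0] H[of 0] by simp
  then obtain r where r: "0 \<le> r" "?H r = \<eta>"
    using R \<eta> \<nu>.isCont_cdf atom IVT[of "cdf \<nu>" 0 \<eta> R] by (auto simp: H)
  have mono: "?H r < ?H r'" if "0 \<le> r" "r < r'" for r r'
  proof -
    have "measure (std_gaussian n) {\<xi> \<in> space (std_gaussian n). sqrt (sq_length n B \<xi>) < r}
        + measure (std_gaussian n) {\<xi> \<in> space (std_gaussian n). r\<^sup>2 < sq_length n B \<xi> \<and> sq_length n B \<xi> < r'\<^sup>2}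
      = measure (std_gaussian n) ({\<xi> \<in> space (std_gaussian n). sqrt (sq_length n B \<xi>) < r}
        \<union> {\<xi> \<in> space (std_gaussian n). r\<^sup>2 < sq_length n B \<xi> \<and> sq_length n B \<xi> < r'\<^sup>2})"
      using that 
      by (intro G.finite_measure_Union[symmetric])
         (auto simp: sqrt_sq_length_less_iff)
    also have "\<dots> \<le> ?H r'"
      using that power_strict_mono[of r r' 2]
      by (intro G.finite_measure_mono) (auto simp: sqrt_sq_length_less_iff)
    finally show ?thesis
      using sq_length_full_support[OF i k B, of "r\<^sup>2" "r'\<^sup>2"] that power_strict_mono[of r r' 2]
      by simp
  qed
  show ?thesis
  proof (rule ex1I[of _ r])
    fix r' assume r': "?H r' = \<eta>"
    then have "0 \<le> r'" using neg[of r'] \<eta> by (cases "r' \<le> 0") auto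
    then show "r' = r" using mono[of r r'] mono[of r' r] r r' by (cases r r' rule: linorder_cases) auto
  qed (rule r)
qed

text \<open>Markov's inequality for the squared length: the complement of the ball has probability
  \<open>1 - \<eta>\<close>, and the mean is the squared Frobenius norm.\<close>

lemma sq_length_quantile_le:
  assumes H: "measure (std_gaussian n) {\<xi> \<in> space (std_gaussian n). sqrt (sq_length n B \<xi>) < r} = \<eta>"
    and \<eta>: "0 < \<eta>" "\<eta> < 1"
  shows "r\<^sup>2 \<le> (\<Sum>i<n. \<Sum>k<n. (B $$ (i, k))\<^sup>2) / (1 - \<eta>)"
proof -
  interpret G: prob_space "std_gaussian n" by (rule prob_space_std_gaussian)
  have r: "r > 0"
  proof (rule ccontr)
    assume "\<not> r > 0"
    then have "{\<xi> \<in> space (std_gaussian n). sqrt (sq_length n B \<xi>) < r} = {}"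
      by (simp add: sqrt_sq_length_not_less)
    with H \<eta> show False by (metis less_irrefl measure_empty)
  qed
  have "1 - \<eta> = measure (std_gaussian n) (space (std_gaussian n) - {\<xi> \<in> space (std_gaussian n). sqrt (sq_length n B \<xi>) < r})"
    by (subst G.prob_compl) (auto simp: H)
  also have "\<dots> = measure (std_gaussian n) {\<xi> \<in> space (std_gaussian n). sq_length n B \<xi> \<ge> r\<^sup>2}"
    using r by (intro arg_cong[where f = "measure _"]) (auto simp: sqrt_sq_length_less_iff)
  also have "\<dots> \<le> (LINT \<xi>|std_gaussian n. sq_length n B \<xi>) / r\<^sup>2"
    using r sq_length_expectation(1)
    by (intro integral_Markov_inequality_measure[where A = "{}"]) (auto simp: sq_length_nonneg)
  finally show ?thesis
    using r \<eta> unfolding sq_length_expectation(2) by (simp add: field_simps)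
qed

text \<open>Transfers the Markov bound to the root chosen inside \<open>gaussian_law\<close>.
  Positivity of \<open>v\<close> rules out \<open>B = 0\<close>, where the law is a point mass and
  no radius has probability \<open>\<eta>\<close>.\<close>

lemma radius_square_le:
  assumes root: "\<exists>B. B \<in> carrier_mat n n \<and> B * B\<^sup>T = 1\<^sub>m n - mat_inv (Sigma_mat n U c)"
    and trace: "\<And>B. B \<in> carrier_mat n n \<Longrightarrow> B * B\<^sup>T = 1\<^sub>m n - mat_inv (Sigma_mat n U c)
      \<Longrightarrow> (\<Sum>i<n. \<Sum>k<n. (B $$ (i, k))\<^sup>2) = v"
    and v: "v > 0" and \<eta>: "0 < \<eta>" "\<eta> < 1"
  shows "(radius n U c \<eta>)\<^sup>2 \<le> v / (1 - \<eta>)"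
proof -
  define B where "B = (SOME B. B \<in> carrier_mat n n \<and> B * B\<^sup>T = 1\<^sub>m n - mat_inv (Sigma_mat n U c))"
  have B: "B \<in> carrier_mat n n" "B * B\<^sup>T = 1\<^sub>m n - mat_inv (Sigma_mat n U c)"
    using someI_ex[OF root] unfolding B_def by auto
  note tr = trace[OF B]
  obtain i k where ik: "i < n" "k < n" "B $$ (i, k) \<noteq> 0"
  proof (rule ccontr)
    assume "\<not> thesis"
    with that have "\<And>i k. i < n \<Longrightarrow> k < n \<Longrightarrow> B $$ (i, k) = 0" by blast
    then have "(\<Sum>i<n. \<Sum>k<n. (B $$ (i, k))\<^sup>2) = 0" by simp
    then show False using tr v by simp
  qed
  let ?G = "gaussian_law n (1\<^sub>m n - mat_inv (Sigma_mat n U c))"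
  let ?T = "\<lambda>\<xi>. \<lambda>i\<in>{..<n}. (B *\<^sub>v Matrix.vec n \<xi>) $ i"
  have G: "?G = distr (std_gaussian n) (PiM {..<n} (\<lambda>_. borel)) ?T"
    by (simp add: gaussian_law_def B_def Let_def)
  have comp: "(B *\<^sub>v Matrix.vec n \<xi>) $ i = (\<Sum>k<n. B $$ (i, k) * \<xi> k)" if "i < n" for \<xi> i
    using that B(1) by (simp add: scalar_prod_def lessThan_atLeast0[symmetric])
  have T: "?T \<in> measurable (std_gaussian n) (PiM {..<n} (\<lambda>_. borel))"
    by (rule measurable_restrict) (simp add: comp)
  have norm: "vnorm (Matrix.vec n g) = sqrt (\<Sum>i<n. (g i)\<^sup>2)" for g
    by (simp add: vnorm_def scalar_prod_def lessThan_atLeast0[symmetric] power2_eq_square)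
  have "measure ?G {g \<in> space ?G. vnorm (Matrix.vec n g) < r}
      = measure (std_gaussian n) {\<xi> \<in> space (std_gaussian n). sqrt (sq_length n B \<xi>) < r}" for r
  proof -
    have "{g \<in> space (PiM {..<n} (\<lambda>_. borel)). vnorm (Matrix.vec n g) < r} \<in> sets (PiM {..<n} (\<lambda>_. borel :: real measure))"
      unfolding norm by measurable
    then show ?thesis
      unfolding G using T
      by (subst measure_distr)
         (auto simp: norm comp sq_length_def space_PiM intro!: arg_cong[where f = "measure _"])
  qed
  then have "radius n U c \<eta>
      = (THE r. measure (std_gaussian n) {\<xi> \<in> space (std_gaussian n). sqrt (sq_length n B \<xi>) < r} = \<eta>)"
    by (simp add: radius_def Let_def)
  with theI'[OF ex1_sq_length_quantile[OF ik \<eta>]]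
  have "measure (std_gaussian n) {\<xi> \<in> space (std_gaussian n). sqrt (sq_length n B \<xi>) < radius n U c \<eta>} = \<eta>"
    by simp
  from sq_length_quantile_le[OF this \<eta>] show ?thesis unfolding tr .
qed

section \<open>Laws with a positive density on a compact interval, and their quantiles\<close>

lemma measure_density_eq_integral:
  fixes h :: "'a \<Rightarrow> real"
  assumes "integrable M h" "\<And>t. h t \<ge> 0" "A \<in> sets M"
  shows "measure (density M (\<lambda>t. ennreal (h t))) A = (LINT t|M. h t * indicator A t)"
proof -
  have int: "integrable M (\<lambda>t. h t * indicator A t)"
    using integrable_mult_indicator[OF assms(3,1)] by (simp add: mult.commute)
  have "emeasure (density M (\<lambda>t. ennreal (h t))) A = (\<integral>\<^sup>+t. ennreal (h t * indicator A t) \<partial>M)"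
    using assms by (subst emeasure_density)
      (auto intro!: nn_integral_cong simp: borel_measurable_integrable split: split_indicator)
  also have "\<dots> = ennreal (LINT t|M. h t * indicator A t)"
    using int assms(2) by (intro nn_integral_eq_integral) auto
  finally show ?thesis
    using assms(2) by (simp add: measure_def integral_nonneg_AE)
qed

text \<open>An unnormalized prior or posterior density. Being positive on all of
  \<open>{a..b}\<close>, it yields a distribution function that is continuous everywhere and
  strictly increasing on \<open>{a..b}\<close>; the quantile lemmas rest on these two facts.\<close>

locale interval_weight =
  fixes g :: "real \<Rightarrow> real" and a b :: real
  assumes ab: "a < b" and g_meas [measurable]: "g \<in> borel_measurable borel"
    and g_int: "integrable lborel g"
    and g_pos: "\<And>t. a \<le> t \<Longrightarrow> t \<le> b \<Longrightarrow> g t > 0"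
    and g_zero: "\<And>t. t < a \<or> b < t \<Longrightarrow> g t = 0"
begin

definition law :: "real measure" where
  "law = density lborel (normalize_density g)"

lemma g_nonneg: "g t \<ge> 0"
  using g_pos[of t] g_zero[of t] by (cases "a \<le> t \<and> t \<le> b") auto

lemma int_restrict: "A \<in> sets borel \<Longrightarrow> integrable lborel (\<lambda>t. g t * indicator A t)"
  using integrable_mult_indicator[of A lborel g] g_int by (simp add: mult.commute)

lemma interval_mass_pos:
  assumes "a \<le> s" "s < t" "t \<le> b"
  shows "(LINT u|lborel. g u * indicator {s<..t} u) > 0"
proof -
  have "(LINT u|lborel. g u * indicator {s<..t} u) \<noteq> 0"
  proof
    assume "(LINT u|lborel. g u * indicator {s<..t} u) = 0"
    then have "AE u in lborel. g u * indicator {s<..t} u = 0"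
      using int_restrict[of "{s<..t}"] g_nonneg by (subst (asm) integral_nonneg_eq_0_iff_AE) auto
    then have "AE u in lborel. u \<notin> {s<..t}"
    proof eventually_elim
      fix u assume "g u * indicator {s<..t} u = 0"
      then show "u \<notin> {s<..t}" using g_pos[of u] assms by (auto split: split_indicator_asm)
    qed
    then have "emeasure lborel {s<..t} = 0"
      using AE_iff_null_sets[of "{s<..t}" lborel] by (simp add: null_sets_def)
    then show False using assms by simp
  qed
  moreover have "(LINT u|lborel. g u * indicator {s<..t} u) \<ge> 0"
    using g_nonneg by (intro integral_nonneg_AE) auto
  ultimately show ?thesis by simp
qed

lemma total_pos: "(LINT t|lborel. g t) > 0"
proof -
  have "0 < (LINT u|lborel. g u * indicator {a<..b} u)" using ab by (intro interval_mass_pos) auto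
  also have "\<dots> \<le> (LINT t|lborel. g t)"
    using g_nonneg by (intro integral_mono g_int int_restrict) (auto split: split_indicator)
  finally show ?thesis .
qed

lemma measure_law:
  assumes "A \<in> sets borel"
  shows "measure law A = (LINT t|lborel. g t * indicator A t) / (LINT t|lborel. g t)"
proof -
  have "measure law A = (LINT t|lborel. normalize_density g t * indicator A t)"
    unfolding law_def using assms g_int g_nonneg total_pos
    by (intro measure_density_eq_integral) (auto simp: normalize_density_def)
  then show ?thesis by (simp add: normalize_density_def)
qed

lemma space_law [simp]: "space law = UNIV" and sets_law [simp]: "sets law = sets borel"
  by (simp_all add: law_def)

lemma prob_law: "prob_space law"
proof
  have "emeasure law UNIV = (\<integral>\<^sup>+t. ennreal (normalize_density g t) \<partial>lborel)"
    unfolding law_def by (subst emeasure_density) (auto simp: normalize_density_def)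
  also have "\<dots> = ennreal (LINT t|lborel. normalize_density g t)"
    using g_int g_nonneg total_pos
    by (intro nn_integral_eq_integral) (auto simp: normalize_density_def)
  also have "\<dots> = 1" using total_pos by (simp add: normalize_density_def)
  finally show "emeasure law (space law) = 1" by simp
qed

sublocale law: real_distribution law
  by (intro real_distribution.intro prob_law real_distribution_axioms.intro) auto

lemma cdf_law_eq:
  "cdf law c = (LINT t|lborel. g t * indicator {..c} t) / (LINT t|lborel. g t)"
  unfolding cdf_def by (rule measure_law) simp

lemma cdf_continuous: "isCont (cdf law) c"
proof -
  have "(LINT t|lborel. g t * indicator {c} t) = 0"
  proof (rule integral_eq_zero_AE)
    have "AE t in lborel. t \<noteq> c" by (rule AE_lborel_singleton)
    then show "AE t in lborel. g t * indicator {c} t = 0" by eventually_elim simp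
  qed
  then show ?thesis by (simp add: law.isCont_cdf measure_law)
qed

lemma cdf_strict_mono:
  assumes "a \<le> s" "s < t" "t \<le> b"
  shows "cdf law s < cdf law t"
proof -
  have "cdf law t - cdf law s = measure law {s<..t}"
    using law.cdf_diff_eq[OF assms(2)] by simp
  also have "\<dots> > 0"
    using interval_mass_pos[OF assms] total_pos by (simp add: measure_law)
  finally show ?thesis by simp
qed

lemma cdf_below: "c \<le> a \<Longrightarrow> cdf law c = 0"
proof -
  assume c: "c \<le> a"
  have "(LINT t|lborel. g t * indicator {..c} t) = 0"
  proof (rule integral_eq_zero_AE)
    have "AE t in lborel. t \<noteq> a" by (rule AE_lborel_singleton)
    then show "AE t in lborel. g t * indicator {..c} t = 0"
      by eventually_elim (use c g_zero in \<open>auto split: split_indicator\<close>)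
  qed
  then show ?thesis by (simp add: cdf_law_eq)
qed

lemma cdf_above: "b \<le> c \<Longrightarrow> cdf law c = 1"
proof -
  assume c: "b \<le> c"
  have "(LINT t|lborel. g t * indicator {..c} t) = (LINT t|lborel. g t)"
    by (intro Bochner_Integration.integral_cong) (use c g_zero in \<open>auto split: split_indicator\<close>)
  then show ?thesis using total_pos by (simp add: cdf_law_eq)
qed

lemma quantile_set:
  assumes "0 < \<alpha>" "\<alpha> < 1"
  shows "bdd_below {t. \<alpha> \<le> cdf law t}" "{t. \<alpha> \<le> cdf law t} \<noteq> {}"
proof -
  show "bdd_below {t. \<alpha> \<le> cdf law t}"
    using assms cdf_below by (intro bdd_belowI[of _ a]) (metis linorder_not_less mem_Collect_eq nle_le)
  have "b \<in> {t. \<alpha> \<le> cdf law t}" using assms cdf_above[of b] by simp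
  then show "{t. \<alpha> \<le> cdf law t} \<noteq> {}" by blast
qed

text \<open>A strict equivalence, false for general laws: strict increase turns
  \<open>\<alpha> \<le> cdf law t\<close> into a strict inequality at \<open>c\<close>, and left
  continuity finds an earlier point still above \<open>\<alpha>\<close>.\<close>

lemma quantile_less_iff:
  assumes \<alpha>: "0 < \<alpha>" "\<alpha> < 1"
  shows "quantile law \<alpha> < c \<longleftrightarrow> \<alpha> < cdf law c"
proof
  assume "quantile law \<alpha> < c"
  then obtain t where t: "t < c" "\<alpha> \<le> cdf law t"
    using cInf_lessD[OF quantile_set(2)[OF \<alpha>]] unfolding quantile_def by auto
  show "\<alpha> < cdf law c"
  proof (cases "c \<le> b")
    case True
    have "a \<le> t" using t(2) \<alpha> cdf_below[of t] by (cases "t \<le> a") auto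
    then show ?thesis using cdf_strict_mono[of t c] t True by linarith
  next
    case False
    then show ?thesis using cdf_above[of c] \<alpha> by simp
  qed
next
  assume "\<alpha> < cdf law c"
  moreover have "(cdf law \<longlongrightarrow> cdf law c) (at_left c)"
    using cdf_continuous[of c] by (simp add: isCont_def filterlim_at_split)
  ultimately have "eventually (\<lambda>t. \<alpha> < cdf law t) (at_left c)"
    by (intro order_tendstoD(1)) auto
  then obtain s where s: "s < c" "\<And>t. s < t \<Longrightarrow> t < c \<Longrightarrow> \<alpha> < cdf law t"
    using eventually_at_left_real[of "c - 1" c] by (auto simp: eventually_at_left_field)
  obtain t where t: "s < t" "t < c" using dense s(1) by blast
  then have "quantile law \<alpha> \<le> t"
    unfolding quantile_def using s quantile_set(1)[OF \<alpha>] by (intro cInf_lower) force+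
  with t show "quantile law \<alpha> < c" by simp
qed

lemma less_quantile_iff:
  assumes \<alpha>: "0 < \<alpha>" "\<alpha> < 1"
  shows "c < quantile law \<alpha> \<longleftrightarrow> cdf law c < \<alpha>"
proof
  assume c: "c < quantile law \<alpha>"
  show "cdf law c < \<alpha>"
  proof (rule ccontr)
    assume "\<not> cdf law c < \<alpha>"
    then have "quantile law \<alpha> \<le> c"
      unfolding quantile_def using quantile_set(1)[OF \<alpha>] by (intro cInf_lower) auto
    with c show False by simp
  qed
next
  assume "cdf law c < \<alpha>"
  moreover have "(cdf law \<longlongrightarrow> cdf law c) (at_right c)"
    using cdf_continuous[of c] by (simp add: isCont_def filterlim_at_split)
  ultimately have "eventually (\<lambda>t. cdf law t < \<alpha>) (at_right c)"
    by (intro order_tendstoD(2)) auto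
  then obtain s where s: "c < s" "\<And>t. c < t \<Longrightarrow> t < s \<Longrightarrow> cdf law t < \<alpha>"
    by (auto simp: eventually_at_right_field)
  obtain t where t: "c < t" "t < s" using dense s(1) by blast
  have "t \<le> u" if "\<alpha> \<le> cdf law u" for u
  proof (rule ccontr)
    assume "\<not> t \<le> u"
    then have "cdf law u \<le> cdf law t" by (intro law.cdf_nondecreasing) simp
    with s(2)[OF t] that show False by simp
  qed
  then have "t \<le> quantile law \<alpha>"
    unfolding quantile_def using quantile_set(2)[OF \<alpha>] by (intro cInf_greatest) auto
  with t show "c < quantile law \<alpha>" by simp
qed

text \<open>Turns a condition on quantiles into one on the distribution function at the fixed point
  \<open>c\<close>. The latter depends continuously on the noise, and the strict inequalities then
  give open sets of noises.\<close>

lemma quantile_interval: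
  assumes "0 < \<alpha>" "\<alpha> < \<beta>" "\<beta> < 1"
  shows "{quantile law \<alpha> <..< quantile law \<beta>} = {c. \<alpha> < cdf law c \<and> cdf law c < \<beta>}"
  using assms by (auto simp: quantile_less_iff less_quantile_iff)

lemma between_quantiles_range:
  assumes "0 < cdf law c" "cdf law c < 1"
  shows "a < c" "c < b"
  using assms cdf_below[of c] cdf_above[of c] by (force simp: not_less[symmetric])+

end

section \<open>Elementary inequalities\<close>

lemma ln_minus_ratio_mono:
  fixes s t :: real
  assumes "0 \<le> s" "s \<le> t"
  shows "ln (1 + s) - s / (1 + s) \<le> ln (1 + t) - t / (1 + t)"
proof (rule DERIV_nonneg_imp_nondecreasing[OF assms(2)])
  fix u assume "s \<le> u" "u \<le> t"
  then have u: "u \<ge> 0" using assms by simp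
  have "((\<lambda>u. ln (1 + u) - u / (1 + u)) has_real_derivative u / (1 + u)\<^sup>2) (at u)"
    by (rule derivative_eq_intros refl | use u in \<open>simp; fail\<close>)+
       (use u in \<open>simp add: divide_simps, simp add: algebra_simps power2_eq_square\<close>)
  then show "\<exists>y. ((\<lambda>u. ln (1 + u) - u / (1 + u)) has_real_derivative y) (at u) \<and> 0 \<le> y"
    using u by (intro exI[of _ "u / (1 + u)\<^sup>2"]) simp
qed

text \<open>The difference of the two sides vanishes at 0 and has a nonnegative derivative. The
  constant 4 is sharp, as the function behaves like \<open>t\<^sup>2 / 2\<close> near 0; it bounds
  the growth of \<open>D2L\<close> when the scale doubles.\<close>

lemma ln_minus_ratio_double:
  fixes t :: real
  assumes "0 \<le> t"
  shows "ln (1 + 2 * t) - 2 * t / (1 + 2 * t) \<le> 4 * (ln (1 + t) - t / (1 + t))"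
proof -
  define h where "h u = 4 * (ln (1 + u) - u / (1 + u)) - (ln (1 + 2 * u) - 2 * u / (1 + 2 * u))" for u :: real
  have "h 0 \<le> h t"
  proof (rule DERIV_nonneg_imp_nondecreasing[OF assms])
    fix u :: real assume u: "0 \<le> u" "u \<le> t"
    have "(h has_real_derivative (4 * (u / (1 + u)\<^sup>2) - 4 * u / (1 + 2 * u)\<^sup>2)) (at u)"
      unfolding h_def
      by (rule derivative_eq_intros refl | use u in \<open>simp; fail\<close>)+
         (use u in \<open>simp add: divide_simps, simp add: algebra_simps power2_eq_square\<close>)
    moreover have "4 * u / (1 + 2 * u)\<^sup>2 \<le> 4 * (u / (1 + u)\<^sup>2)"
      using u by (auto intro!: frac_le power_mono)
    ultimately show "\<exists>y. (h has_real_derivative y) (at u) \<and> 0 \<le> y"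
      by (intro exI[of _ "4 * (u / (1 + u)\<^sup>2) - 4 * u / (1 + 2 * u)\<^sup>2"]) simp
  qed
  then show ?thesis by (simp add: h_def)
qed

lemma vnorm_eq_L2_set: "v \<in> carrier_vec n \<Longrightarrow> vnorm v = L2_set (\<lambda>i. v $ i) {..<n}"
  by (simp add: vnorm_def L2_set_def scalar_prod_def lessThan_atLeast0[symmetric] power2_eq_square)

lemma vnorm_nonneg: "vnorm v \<ge> 0"
  by (simp add: vnorm_def scalar_prod_def sum_nonneg)

lemma vnorm_triangle:
  assumes "u \<in> carrier_vec n" "v \<in> carrier_vec n" "w \<in> carrier_vec n"
  shows "vnorm (u - w) \<le> vnorm (u - v) + vnorm (v - w)"
proof -
  have "L2_set (\<lambda>i. (u $ i - v $ i) + (v $ i - w $ i)) {..<n}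
      \<le> L2_set (\<lambda>i. u $ i - v $ i) {..<n} + L2_set (\<lambda>i. v $ i - w $ i) {..<n}"
    by (rule L2_set_triangle_ineq)
  then show ?thesis
    using assms by (simp add: vnorm_eq_L2_set[of _ n] cong: L2_set_cong_simp)
qed

lemma vnorm_minus_commute:
  assumes "u \<in> carrier_vec n" "v \<in> carrier_vec n"
  shows "vnorm (u - v) = vnorm (v - u)"
  using assms by (simp add: vnorm_def scalar_prod_def algebra_simps)

section \<open>Likelihood, estimation error and radius in eigencoordinates\<close>

locale regression = eigenbasis n U "e n" "\<mu> n"
  for n :: nat and U :: "real mat" and e :: "nat \<Rightarrow> nat \<Rightarrow> real Matrix.vec" and \<mu> :: "nat \<Rightarrow> nat \<Rightarrow> real" +
  fixes x :: "nat \<Rightarrow> nat \<Rightarrow> 'x" and f :: "'x \<Rightarrow> real"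
  assumes \<mu>_nonneg: "\<And>j. j < n \<Longrightarrow> \<mu> n j \<ge> 0"
begin

abbreviation "fj \<equiv> f_coef x e f n"
abbreviation "Z \<equiv> Z_coef e n"
abbreviation "Y \<equiv> obs x f n"
abbreviation "D \<equiv> DL x e \<mu> f n"

lemma denom_pos: "c \<ge> 0 \<Longrightarrow> j < n \<Longrightarrow> 1 + c * \<mu> n j > 0"
  by (rule one_plus_pos) (use \<mu>_nonneg in auto)

lemma design_vec_carrier [simp]: "design_vec x g n \<in> carrier_vec n"
  by (simp add: design_vec_def)

lemma Y_carrier [simp]: "Y \<epsilon> \<in> carrier_vec n"
  by (simp add: obs_def design_vec_def)

lemma Y_coef: "j < n \<Longrightarrow> Y \<epsilon> \<bullet> e n j = fj j + Z \<epsilon> j"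
  unfolding obs_def f_coef_def Z_coef_def
  by (rule add_scalar_prod_distrib[where n = n]) (auto simp: design_vec_def)

lemma Z_eq: "j < n \<Longrightarrow> Z \<epsilon> j = (\<Sum>i<n. e n j $ i * \<epsilon> i)"
  by (simp add: Z_coef_def scalar_prod_def lessThan_atLeast0[symmetric] mult.commute)

lemma Z_continuous: "j < n \<Longrightarrow> continuous_on UNIV (\<lambda>\<epsilon>. Z \<epsilon> j)"
  by (simp add: Z_eq continuous_sum_coords)

text \<open>The squared noise over \<open>1 + c * \<mu> n j\<close> is the squared noise minus its
  multiple by \<open>c * \<mu> n j / (1 + c * \<mu> n j)\<close>. Centring the latter at 1 yields
  the summand of \<open>R2L\<close> and the ratio that completes the logarithm to
  \<open>D2L\<close>. The remaining sum of squares is free of \<open>c\<close> and cancels in the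
  posterior.\<close>

lemma neg2_log_likelihood:
  assumes c: "c \<ge> 0"
  shows "ln (Determinant.det (Sigma_mat n U c)) + Y \<epsilon> \<bullet> (mat_inv (Sigma_mat n U c) *\<^sub>v Y \<epsilon>)
    = D c + R1L x e \<mu> f n \<epsilon> c + R2L e \<mu> n \<epsilon> c + (\<Sum>j<n. (Z \<epsilon> j)\<^sup>2)"
proof -
  have "ln (Determinant.det (Sigma_mat n U c)) = (\<Sum>j<n. ln (1 + c * \<mu> n j))"
    unfolding det_Sigma using denom_pos[OF c] by (intro ln_prod) force+
  moreover have "Y \<epsilon> \<bullet> (mat_inv (Sigma_mat n U c) *\<^sub>v Y \<epsilon>)
      = (\<Sum>j<n. (fj j)\<^sup>2 / (1 + c * \<mu> n j) - c * \<mu> n j / (1 + c * \<mu> n j)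
          + 2 * (Z \<epsilon> j * fj j / (1 + c * \<mu> n j))
          - ((Z \<epsilon> j)\<^sup>2 - 1) * (c * \<mu> n j) / (1 + c * \<mu> n j) + (Z \<epsilon> j)\<^sup>2)"
    (is "_ = (\<Sum>j<n. ?s j)")
  proof -
    have "Y \<epsilon> \<bullet> (mat_inv (Sigma_mat n U c) *\<^sub>v Y \<epsilon>) = (\<Sum>j<n. (fj j + Z \<epsilon> j)\<^sup>2 / (1 + c * \<mu> n j))"
      using quadratic_form[OF c \<mu>_nonneg Y_carrier] by (simp add: Y_coef)
    also have "\<dots> = (\<Sum>j<n. ?s j)"
    proof (rule sum.cong[OF refl])
      fix j assume "j \<in> {..<n}"
      then have "1 + c * \<mu> n j \<noteq> 0" using denom_pos[OF c, of j] by simp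
      then show "(fj j + Z \<epsilon> j)\<^sup>2 / (1 + c * \<mu> n j) = ?s j"
        by (simp add: divide_simps) (simp add: algebra_simps power2_eq_square)
    qed
    finally show ?thesis .
  qed
  ultimately show ?thesis
    by (simp add: DL_def D1L_def D2L_def R1L_def R2L_def sum.distrib sum_subtractf sum_distrib_left)
qed

text \<open>Coordinate \<open>j\<close> of the error is \<open>(fj j - c * \<mu> n j * Z \<epsilon>
  j) / (1 + c * \<mu> n j)\<close>; expanding its square gives the four terms, \<open>D2R\<close>
  being the mean of the noise part. Only the bias term is estimated: its denominator is a square,
  that of \<open>D1L\<close> a first power.\<close>

lemma squared_error:
  assumes c: "c \<ge> 0"
  shows "(vnorm (design_vec x f n - fhat n U c (Y \<epsilon>)))\<^sup>2
    \<le> D1L x e \<mu> f n c + D2R \<mu> n c + R3 x e \<mu> f n \<epsilon> c + R4 e \<mu> n \<epsilon> c"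
proof -
  have car: "fhat n U c (Y \<epsilon>) \<in> carrier_vec n"
    using fhat_carrier[OF c \<mu>_nonneg] by simp
  have "(vnorm (design_vec x f n - fhat n U c (Y \<epsilon>)))\<^sup>2
      = (\<Sum>j<n. ((design_vec x f n - fhat n U c (Y \<epsilon>)) \<bullet> e n j)\<^sup>2)"
    using car by (intro vnorm_square) simp
  also have "\<dots> \<le> (\<Sum>j<n. (fj j)\<^sup>2 / (1 + c * \<mu> n j)
      + (c * \<mu> n j)\<^sup>2 / (1 + c * \<mu> n j)\<^sup>2
      - 2 * (c * \<mu> n j * Z \<epsilon> j * fj j / (1 + c * \<mu> n j)\<^sup>2)
      + (c * \<mu> n j)\<^sup>2 * ((Z \<epsilon> j)\<^sup>2 - 1) / (1 + c * \<mu> n j)\<^sup>2)"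
  proof (rule sum_mono)
    fix j assume "j \<in> {..<n}"
    then have j: "j < n" by simp
    note p = denom_pos[OF c j]
    have "(design_vec x f n - fhat n U c (Y \<epsilon>)) \<bullet> e n j = fj j - fhat n U c (Y \<epsilon>) \<bullet> e n j"
      unfolding f_coef_def using j car by (intro minus_scalar_prod_distrib) auto
    also have "\<dots> = fj j - c * \<mu> n j / (1 + c * \<mu> n j) * (fj j + Z \<epsilon> j)"
      using fhat_coef[OF c \<mu>_nonneg Y_carrier j] by (simp add: Y_coef[OF j])
    also have "\<dots> = (fj j - c * \<mu> n j * Z \<epsilon> j) / (1 + c * \<mu> n j)"
      using p by (simp add: field_simps)
    finally have coef: "(design_vec x f n - fhat n U c (Y \<epsilon>)) \<bullet> e n j
        = (fj j - c * \<mu> n j * Z \<epsilon> j) / (1 + c * \<mu> n j)" .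
    have "((design_vec x f n - fhat n U c (Y \<epsilon>)) \<bullet> e n j)\<^sup>2
        = (fj j)\<^sup>2 / (1 + c * \<mu> n j)\<^sup>2 + (c * \<mu> n j)\<^sup>2 / (1 + c * \<mu> n j)\<^sup>2
          - 2 * (c * \<mu> n j * Z \<epsilon> j * fj j / (1 + c * \<mu> n j)\<^sup>2)
          + (c * \<mu> n j)\<^sup>2 * ((Z \<epsilon> j)\<^sup>2 - 1) / (1 + c * \<mu> n j)\<^sup>2"
      unfolding coef using p by (simp add: divide_simps) (simp add: algebra_simps power2_eq_square)
    moreover have "1 + c * \<mu> n j \<ge> 1" using c \<mu>_nonneg[OF j] by simp
    then have "(fj j)\<^sup>2 / (1 + c * \<mu> n j)\<^sup>2 \<le> (fj j)\<^sup>2 / (1 + c * \<mu> n j)"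
      by (intro divide_left_mono) (auto simp: power2_eq_square)
    ultimately show "((design_vec x f n - fhat n U c (Y \<epsilon>)) \<bullet> e n j)\<^sup>2
      \<le> (fj j)\<^sup>2 / (1 + c * \<mu> n j) + (c * \<mu> n j)\<^sup>2 / (1 + c * \<mu> n j)\<^sup>2
        - 2 * (c * \<mu> n j * Z \<epsilon> j * fj j / (1 + c * \<mu> n j)\<^sup>2)
        + (c * \<mu> n j)\<^sup>2 * ((Z \<epsilon> j)\<^sup>2 - 1) / (1 + c * \<mu> n j)\<^sup>2"
      by simp
  qed
  finally show ?thesis
    by (simp add: D1L_def D2R_def R3_def R4_def sum.distrib sum_subtractf sum_distrib_left sum_negf)
qed

lemma D1L_antimono: "0 \<le> c \<Longrightarrow> c \<le> c' \<Longrightarrow> D1L x e \<mu> f n c' \<le> D1L x e \<mu> f n c"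
  unfolding D1L_def
  by (intro sum_mono divide_left_mono add_left_mono mult_right_mono mult_pos_pos denom_pos \<mu>_nonneg) auto

lemma D1L_nonneg: "0 \<le> c \<Longrightarrow> D1L x e \<mu> f n c \<ge> 0"
  unfolding D1L_def using denom_pos by (intro sum_nonneg) (force intro: less_imp_le)

lemma D2L_mono: "0 \<le> c \<Longrightarrow> c \<le> c' \<Longrightarrow> D2L \<mu> n c \<le> D2L \<mu> n c'"
  unfolding D2L_def by (intro sum_mono ln_minus_ratio_mono mult_right_mono \<mu>_nonneg mult_nonneg_nonneg) auto

lemma D2L_nonneg: "0 \<le> c \<Longrightarrow> D2L \<mu> n c \<ge> 0"
  using D2L_mono[of 0 c] by (simp add: D2L_def)

lemma D2L_double: "0 \<le> c \<Longrightarrow> D2L \<mu> n (2 * c) \<le> 4 * D2L \<mu> n c"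
  unfolding D2L_def sum_distrib_left
  by (intro sum_mono) (use ln_minus_ratio_double \<mu>_nonneg in \<open>simp add: mult.assoc\<close>)

lemma s2_nonneg: "0 \<le> c \<Longrightarrow> s2 \<mu> n c \<ge> 0"
  unfolding s2_def using denom_pos \<mu>_nonneg
  by (intro sum_nonneg) (force intro: less_imp_le divide_nonneg_pos)

lemma s2_le: "0 \<le> c \<Longrightarrow> s2 \<mu> n c \<le> n"
proof -
  assume c: "0 \<le> c"
  have "s2 \<mu> n c \<le> (\<Sum>j<n. 1)"
    unfolding s2_def using denom_pos[OF c] by (intro sum_mono) (force simp: divide_le_eq)
  then show ?thesis by simp
qed

lemma radius_square_le_s2:
  assumes c: "c \<ge> 0" and s: "s2 \<mu> n c > 0" and \<eta>: "0 < \<eta>" "\<eta> < 1"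
  shows "(radius n U c \<eta>)\<^sup>2 \<le> s2 \<mu> n c / (1 - \<eta>)"
  using ex_cov_root[OF c \<mu>_nonneg] trace_cov_root[OF c \<mu>_nonneg] s \<eta>
  by (intro radius_square_le) (auto simp: s2_def)

lemma terms_continuous:
  assumes "I \<subseteq> {0..}"
  shows "continuous_on I D"
    and "continuous_on I (R1L x e \<mu> f n \<epsilon>)" "continuous_on I (R2L e \<mu> n \<epsilon>)"
    and "continuous_on I (R3 x e \<mu> f n \<epsilon>)" "continuous_on I (R4 e \<mu> n \<epsilon>)"
proof -
  have p: "1 + c * \<mu> n j > 0" if "c \<in> I" "j < n" for c j
    using denom_pos that assms by auto
  have "1 + c * \<mu> n j \<noteq> 0" if "c \<in> I" "j < n" for c j
    using p[OF that] by simp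
  with p show "continuous_on I D"
    and "continuous_on I (R1L x e \<mu> f n \<epsilon>)" "continuous_on I (R2L e \<mu> n \<epsilon>)"
    and "continuous_on I (R3 x e \<mu> f n \<epsilon>)" "continuous_on I (R4 e \<mu> n \<epsilon>)"
    unfolding DL_def D1L_def D2L_def R1L_def[abs_def] R2L_def[abs_def] R3_def[abs_def] R4_def[abs_def]
    by (auto intro!: continuous_intros)
qed

lemma noise_terms_continuous:
  shows "continuous_on UNIV (\<lambda>\<epsilon>. R1L x e \<mu> f n \<epsilon> c)" "continuous_on UNIV (\<lambda>\<epsilon>. R2L e \<mu> n \<epsilon> c)"
    and "continuous_on UNIV (\<lambda>\<epsilon>. R3 x e \<mu> f n \<epsilon> c)" "continuous_on UNIV (\<lambda>\<epsilon>. R4 e \<mu> n \<epsilon> c)"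
  unfolding R1L_def[abs_def] R2L_def[abs_def] R3_def[abs_def] R4_def[abs_def] divide_inverse
  by (auto intro!: continuous_intros Z_continuous)

end

section \<open>Integral bound for the hyperprior\<close>

lemma interval_weight_continuous:
  fixes h :: "real \<Rightarrow> real"
  assumes ab: "a < b" and h: "continuous_on {a..b} h" and pos: "\<And>t. a \<le> t \<Longrightarrow> t \<le> b \<Longrightarrow> h t > 0"
  shows "interval_weight (\<lambda>t. if t \<in> {a..b} then h t else 0) a b"
proof -
  have "integrable lborel (\<lambda>t. indicator {a..b} t *\<^sub>R h t)"
    using h by (intro borel_integrable_compact) auto
  moreover have "(\<lambda>t. indicator {a..b} t *\<^sub>R h t) = (\<lambda>t. if t \<in> {a..b} then h t else 0)"
    by (auto simp: fun_eq_iff)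
  ultimately have int: "integrable lborel (\<lambda>t. if t \<in> {a..b} then h t else 0)" by simp
  then have "(\<lambda>t. if t \<in> {a..b} then h t else 0) \<in> borel_measurable borel"
    using borel_measurable_integrable by force
  with int show ?thesis using ab pos by unfold_locales auto
qed

text \<open>The integral of \<open>C powr (1 + \<kappa>) * (1 + t) powr (- 1 - \<kappa>)\<close>
  over the positive half line, where \<open>C = max 1 ((1 + \<kappa>) / \<alpha>)\<close>: a
  majorant of the inverse gamma weight, free of the endpoints of the interval.\<close>

definition hyperprior_bound :: "real \<Rightarrow> real \<Rightarrow> real" where
  "hyperprior_bound \<kappa> \<alpha> = max 1 ((1 + \<kappa>) / \<alpha>) powr (1 + \<kappa>) / \<kappa>"

text \<open>The factor \<open>exp (- \<alpha> / t)\<close> compensates the singularity of the power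
  at 0 and leaves a multiple of \<open>(1 + t) powr (- 1 - \<kappa>)\<close>, which has an explicit
  antiderivative. The bound has to be uniform in \<open>a\<close> and \<open>b\<close>, since both
  vary with \<open>n\<close> in the application.\<close>

lemma hyperprior_integral_le:
  fixes \<kappa> \<alpha> a b :: real
  assumes "\<kappa> > 0" "\<alpha> > 0" "0 < a" "a \<le> b"
  shows "(LINT t|lborel. (if t \<in> {a..b} then t powr (- 1 - \<kappa>) * exp (- \<alpha> / t) else 0)) \<le> hyperprior_bound \<kappa> \<alpha>"
proof -
  define C where "C = max 1 ((1 + \<kappa>) / \<alpha>)"
  have C: "C \<ge> 1" "(1 + \<kappa>) / \<alpha> \<le> C" by (auto simp: C_def)
  have bound: "t powr (- 1 - \<kappa>) * exp (- \<alpha> / t) \<le> C powr (1 + \<kappa>) * (1 + t) powr (- 1 - \<kappa>)"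
    if t: "t > 0" for t
  proof -
    \<comment> \<open>Chosen so that \<open>exp (\<beta> / t)\<close> to the power
      \<open>1 + \<kappa>\<close> is \<open>exp (\<alpha> / t)\<close>; the two parts of the maximum
      \<open>C\<close> serve \<open>C \<ge> 1\<close> and
      \<open>C * \<beta> \<ge> 1\<close>.\<close>
    define \<beta> where "\<beta> = \<alpha> / (1 + \<kappa>)"
    have \<beta>: "\<beta> > 0" "1 \<le> C * \<beta>" using assms C by (auto simp: \<beta>_def field_simps)
    have "1 + 1 / t \<le> C * (1 + \<beta> / t)"
      using C(1) divide_right_mono[OF \<beta>(2), of t] t by (simp add: algebra_simps)
    also have "\<dots> \<le> C * exp (\<beta> / t)" using C by (intro mult_left_mono exp_ge_add_one_self) auto
    finally have "(1 + 1 / t) powr (1 + \<kappa>) \<le> (C * exp (\<beta> / t)) powr (1 + \<kappa>)"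
      using t assms by (intro powr_mono2) auto
    also have "\<dots> = C powr (1 + \<kappa>) * exp (\<alpha> / t)"
      using C assms by (simp add: powr_mult exp_powr_real \<beta>_def)
    finally have 1: "(1 + 1 / t) powr (1 + \<kappa>) \<le> C powr (1 + \<kappa>) * exp (\<alpha> / t)" .
    have "1 + 1 / t = (1 + t) / t" using t by (simp add: field_simps)
    then have 2: "(1 + 1 / t) powr (1 + \<kappa>) = (1 + t) powr (1 + \<kappa>) * t powr (- 1 - \<kappa>)"
      using t by (simp add: powr_divide powr_minus_divide[of t "1 + \<kappa>", simplified] )
    have e: "exp (\<alpha> / t) * exp (- \<alpha> / t) = 1" by (simp add: exp_add[symmetric])
    have p: "(1 + t) powr (1 + \<kappa>) * (1 + t) powr (- 1 - \<kappa>) = 1"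
      using t by (simp add: powr_add[symmetric])
    have "t powr (- 1 - \<kappa>) * exp (- \<alpha> / t)
        = ((1 + 1 / t) powr (1 + \<kappa>)) * ((1 + t) powr (- 1 - \<kappa>) * exp (- \<alpha> / t))"
      unfolding 2 using p by (simp add: algebra_simps)
    also have "\<dots> \<le> (C powr (1 + \<kappa>) * exp (\<alpha> / t)) * ((1 + t) powr (- 1 - \<kappa>) * exp (- \<alpha> / t))"
      by (rule mult_right_mono[OF 1]) simp
    also have "\<dots> = C powr (1 + \<kappa>) * (1 + t) powr (- 1 - \<kappa>)"
      using e by (simp add: algebra_simps)
    finally show ?thesis .
  qed
  have cont1: "continuous_on {a..b} (\<lambda>t. t powr (- 1 - \<kappa>) * exp (- \<alpha> / t))"
    using assms by (auto intro!: continuous_intros)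
  have cont2: "isCont (\<lambda>t. C powr (1 + \<kappa>) * (1 + t) powr (- 1 - \<kappa>)) t" if "a \<le> t" "t \<le> b" for t
    using assms that by (intro continuous_intros) auto
  have int1: "integrable lborel (\<lambda>t. indicator {a..b} t *\<^sub>R (t powr (- 1 - \<kappa>) * exp (- \<alpha> / t)))"
    by (rule borel_integrable_compact[OF _ cont1]) simp
  have int2: "integrable lborel (\<lambda>t. indicator {a..b} t *\<^sub>R (C powr (1 + \<kappa>) * (1 + t) powr (- 1 - \<kappa>)))"
    using cont2 by (intro borel_integrable_compact) (auto intro!: continuous_at_imp_continuous_on)
  have "(LINT t|lborel. (if t \<in> {a..b} then t powr (- 1 - \<kappa>) * exp (- \<alpha> / t) else 0))
      = (LINT t|lborel. indicator {a..b} t *\<^sub>R (t powr (- 1 - \<kappa>) * exp (- \<alpha> / t)))"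
    by (intro Bochner_Integration.integral_cong) (auto split: split_indicator)
  also have "\<dots> \<le> (LINT t|lborel. indicator {a..b} t *\<^sub>R (C powr (1 + \<kappa>) * (1 + t) powr (- 1 - \<kappa>)))"
    using assms bound by (intro integral_mono int1 int2) (auto split: split_indicator)
  also have "\<dots> = (- (C powr (1 + \<kappa>) / \<kappa>) * (1 + b) powr (- \<kappa>)) - (- (C powr (1 + \<kappa>) / \<kappa>) * (1 + a) powr (- \<kappa>))"
  proof -
    have "(LINT t|lborel. (C powr (1 + \<kappa>) * (1 + t) powr (- 1 - \<kappa>)) * indicator {a..b} t)
      = (- (C powr (1 + \<kappa>) / \<kappa>) * (1 + b) powr (- \<kappa>)) - (- (C powr (1 + \<kappa>) / \<kappa>) * (1 + a) powr (- \<kappa>))"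
    proof (rule integral_FTC_Icc_real[where F = "\<lambda>t. - (C powr (1 + \<kappa>) / \<kappa>) * (1 + t) powr (- \<kappa>)"])
      fix t assume t: "a \<le> t" "t \<le> b"
      have eq: "- \<kappa> - 1 = - 1 - \<kappa>" by simp
      have "((\<lambda>t. (1 + t) powr (- \<kappa>)) has_real_derivative (- \<kappa> * (1 + t) powr (- \<kappa> - 1))) (at t)"
        using t assms by (auto intro!: derivative_eq_intros)
      from DERIV_cmult[OF this, of "- (C powr (1 + \<kappa>) / \<kappa>)"]
      show "((\<lambda>t. - (C powr (1 + \<kappa>) / \<kappa>) * (1 + t) powr (- \<kappa>)) has_real_derivative
          C powr (1 + \<kappa>) * (1 + t) powr (- 1 - \<kappa>)) (at t)"
        using assms by (simp add: eq)
    qed (use assms cont2 in auto)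
    then show ?thesis by (simp add: mult.commute)
  qed
  also have "\<dots> \<le> C powr (1 + \<kappa>) / \<kappa> * (1 + a) powr (- \<kappa>)" using assms by simp
  also have "\<dots> \<le> C powr (1 + \<kappa>) / \<kappa> * 1"
    using assms powr_mono2'[of "- \<kappa>" 1 "1 + a"] by (intro mult_left_mono) auto
  finally show ?thesis by (simp add: hyperprior_bound_def C_def)
qed


section \<open>The posterior of the scale and its tails\<close>

text \<open>One sample size for which \<open>scale_range\<close> is a proper interval of positive
  numbers. For \<open>n \<le> 1\<close> its left end is 0, so the locale can be entered for large
  \<open>n\<close> only.\<close>

locale hierarchical_bayes = regression n U e \<mu> x f
  for n U e \<mu> and x :: "nat \<Rightarrow> nat \<Rightarrow> 'x" and f +
  fixes m \<kappa> lam a b :: real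
  assumes \<kappa>: "\<kappa> > 0" and lam: "lam > 0" and a_pos: "0 < a" and a_less_b: "a < b"
    and range_eq: "scale_range m n = {a..b}"
begin

definition prior_mass :: real where
  "prior_mass = (LINT t|lborel. (if t \<in> {a..b} then t powr (- 1 - \<kappa>) * exp (- lam / t) else 0))"

lemma prior_weight: "interval_weight (\<lambda>t. if t \<in> {a..b} then t powr (- 1 - \<kappa>) * exp (- lam / t) else 0) a b"
  using a_pos a_less_b by (intro interval_weight_continuous) (auto intro!: continuous_intros mult_pos_pos)

lemma prior_mass_pos: "prior_mass > 0"
  unfolding prior_mass_def by (rule interval_weight.total_pos[OF prior_weight])

definition weight :: "(nat \<Rightarrow> real) \<Rightarrow> real \<Rightarrow> real" where
  "weight \<epsilon> t = Determinant.det (Sigma_mat n U t) powr (- 1 / 2)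
     * exp (- (1 / 2) * (Y \<epsilon> \<bullet> (mat_inv (Sigma_mat n U t) *\<^sub>v Y \<epsilon>))) * prior_density m \<kappa> lam n t"

lemma posterior_eq: "posterior m \<kappa> lam n U (Y \<epsilon>) = density lborel (normalize_density (weight \<epsilon>))"
  by (simp add: posterior_def weight_def[abs_def])

lemma prior_density_eq:
  "prior_density m \<kappa> lam n t = (if t \<in> {a..b} then t powr (- 1 - \<kappa>) * exp (- lam / t) else 0) / prior_mass"
  by (simp add: prior_density_def normalize_density_def prior_mass_def range_eq)

lemma det_Sigma_ge_1: "t \<ge> 0 \<Longrightarrow> Determinant.det (Sigma_mat n U t) \<ge> 1"
  unfolding det_Sigma using \<mu>_nonneg by (intro prod_ge_1) auto

text \<open>Minus twice the log likelihood of \<open>t\<close>, without the constant from the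
  Gaussian normalization, in the expanded form of \<open>neg2_log_likelihood\<close>.\<close>

definition deviance :: "(nat \<Rightarrow> real) \<Rightarrow> real \<Rightarrow> real" where
  "deviance \<epsilon> t = D t + R1L x e \<mu> f n \<epsilon> t + R2L e \<mu> n \<epsilon> t + (\<Sum>j<n. (Z \<epsilon> j)\<^sup>2)"

lemma likelihood_eq:
  assumes "t \<ge> 0"
  shows "Determinant.det (Sigma_mat n U t) powr (- 1 / 2)
     * exp (- (1 / 2) * (Y \<epsilon> \<bullet> (mat_inv (Sigma_mat n U t) *\<^sub>v Y \<epsilon>))) = exp (- deviance \<epsilon> t / 2)"
proof -
  have "Determinant.det (Sigma_mat n U t) powr (- 1 / 2) = exp (- ln (Determinant.det (Sigma_mat n U t)) / 2)"
    using det_Sigma_ge_1[OF assms] by (simp add: powr_def)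
  then show ?thesis
    using neg2_log_likelihood[OF assms, of \<epsilon>]
    by (simp add: deviance_def exp_add[symmetric] add_divide_distrib[symmetric])
qed

lemma weight_eq:
  "weight \<epsilon> t = (if t \<in> {a..b} then exp (- deviance \<epsilon> t / 2) * (t powr (- 1 - \<kappa>) * exp (- lam / t)) / prior_mass else 0)"
  unfolding weight_def prior_density_eq using a_pos likelihood_eq[of t \<epsilon>] by auto

text \<open>The determinant is at least 1 and the quadratic form is nonnegative. The likelihood is
  thus at most 1, which lets the prior density dominate all posterior weights.\<close>

lemma deviance_nonneg:
  assumes "t \<ge> 0" shows "deviance \<epsilon> t \<ge> 0"
proof -
  have "Y \<epsilon> \<bullet> (mat_inv (Sigma_mat n U t) *\<^sub>v Y \<epsilon>) \<ge> 0"
    using denom_pos[OF assms] quadratic_form[OF assms \<mu>_nonneg Y_carrier, of \<epsilon>]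
    by (auto intro!: sum_nonneg divide_nonneg_pos)
  then show ?thesis
    using neg2_log_likelihood[OF assms, of \<epsilon>] det_Sigma_ge_1[OF assms] unfolding deviance_def
    by (smt (verit) ln_ge_zero)
qed

lemma deviance_continuous:
  "continuous_on {a..b} (deviance \<epsilon>)" "continuous_on UNIV (\<lambda>\<epsilon>. deviance \<epsilon> t)"
  unfolding deviance_def[abs_def] using a_pos
  by (auto intro!: continuous_intros terms_continuous noise_terms_continuous Z_continuous)

lemma weight_interval: "interval_weight (weight \<epsilon>) a b"
  unfolding weight_eq[abs_def] using a_pos a_less_b prior_mass_pos deviance_continuous
  by (intro interval_weight_continuous) (auto intro!: continuous_intros mult_pos_pos divide_pos_pos)

sublocale post: interval_weight "weight \<epsilon>" a b for \<epsilon>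
  by (rule weight_interval)

lemma posterior_law: "posterior m \<kappa> lam n U (Y \<epsilon>) = post.law \<epsilon>"
  by (simp add: posterior_eq post.law_def)

text \<open>Dominated convergence with the prior density as majorant. Sequences suffice in the
  countable product \<open>nat \<Rightarrow> real\<close>, and the deviance is continuous in the
  noise for each fixed \<open>t\<close>.\<close>

lemma weight_integral_continuous:
  assumes "A \<in> sets borel"
  shows "continuous_on UNIV (\<lambda>\<epsilon>. LINT t|lborel. weight \<epsilon> t * indicator A t)"
proof (rule continuous_on_sequentiallyI)
  fix u :: "nat \<Rightarrow> nat \<Rightarrow> real" and \<epsilon>
  assume u: "u \<longlonglongrightarrow> \<epsilon>"
  let ?w = "\<lambda>t. (if t \<in> {a..b} then t powr (- 1 - \<kappa>) * exp (- lam / t) else 0) / prior_mass"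
  show "(\<lambda>i. LINT t|lborel. weight (u i) t * indicator A t) \<longlonglongrightarrow> (LINT t|lborel. weight \<epsilon> t * indicator A t)"
  proof (rule integral_dominated_convergence[where w = ?w])
    show "integrable lborel ?w"
      using interval_weight.g_int[OF prior_weight] by simp
    show "AE t in lborel. (\<lambda>i. weight (u i) t * indicator A t) \<longlonglongrightarrow> weight \<epsilon> t * indicator A t"
    proof (rule AE_I2)
      fix t
      have "(\<lambda>i. deviance (u i) t) \<longlonglongrightarrow> deviance \<epsilon> t"
        using deviance_continuous(2)[of t] u unfolding continuous_on_sequentially by (auto simp: o_def)
      then show "(\<lambda>i. weight (u i) t * indicator A t) \<longlonglongrightarrow> weight \<epsilon> t * indicator A t"
        unfolding weight_eq using prior_mass_pos by (auto intro!: tendsto_intros)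
    qed
    show "AE t in lborel. norm (weight (u i) t * indicator A t) \<le> ?w t" for i
    proof (rule AE_I2)
      fix t
      have "exp (- deviance (u i) t / 2) \<le> 1" if "t \<in> {a..b}"
        using that a_pos deviance_nonneg[of t "u i"] by simp
      then have "weight (u i) t \<le> ?w t"
        unfolding weight_eq using prior_mass_pos
        by (auto intro!: divide_right_mono mult_left_le_one_le)
      then show "norm (weight (u i) t * indicator A t) \<le> ?w t"
        using post.g_nonneg[of "u i" t] by (auto split: split_indicator)
    qed
  qed (use assms post.int_restrict in \<open>auto intro: borel_measurable_integrable\<close>)
qed

lemma cdf_posterior_continuous: "continuous_on UNIV (\<lambda>\<epsilon>. cdf (post.law \<epsilon>) t)"
  unfolding post.cdf_law_eq
  using weight_integral_continuous[of "{..t}"] weight_integral_continuous[of UNIV] post.total_pos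
  by (intro continuous_on_divide) (auto simp: less_imp_neq[symmetric])

text \<open>Quotient of an upper bound for the weight of \<open>A\<close> and a lower bound for the
  total weight. The set stays arbitrary, since it will be a right or a left tail depending on the
  position of the point in question.\<close>

lemma posterior_tail:
  assumes cn: "c \<in> {a..b}" "2 * c \<in> {a..b}" and ln_c: "ln c \<le> g"
    and g: "D c + 2 * lam / c \<le> g"
    and noise: "\<And>t. t \<in> {a..b} \<Longrightarrow> \<bar>R1L x e \<mu> f n \<epsilon> t\<bar> + \<bar>R2L e \<mu> n \<epsilon> t\<bar> \<le> D t / 2"
    and A: "A \<in> sets borel" "\<And>t. t \<in> A \<Longrightarrow> t \<in> {a..b} \<Longrightarrow> D t + 2 * lam / t \<ge> 8 * (5 + \<kappa>) * g"
  shows "measure (post.law \<epsilon>) A \<le> hyperprior_bound \<kappa> (3 * lam / 4) * 2 powr (1 + \<kappa>) * exp (- g)"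
proof -
  \<comment> \<open>Collects the factors free of \<open>t\<close>; it cancels in the final
    quotient.\<close>
  define S where "S = exp (- (\<Sum>j<n. (Z \<epsilon> j)\<^sup>2) / 2) / prior_mass"
  have S: "S > 0" using prior_mass_pos by (simp add: S_def)
  define r where "r t = D t + R1L x e \<mu> f n \<epsilon> t + R2L e \<mu> n \<epsilon> t" for t
  have w: "weight \<epsilon> t = S * (t powr (- 1 - \<kappa>) * exp (- lam / t - r t / 2))" if "t \<in> {a..b}" for t
    using that unfolding weight_eq deviance_def S_def r_def
    by (simp add: exp_add[symmetric] exp_diff[symmetric] mult.assoc[symmetric])
       (simp add: exp_add[symmetric] field_simps)
  have r: "D t / 2 \<le> r t" "r t \<le> 3 / 2 * D t" if "t \<in> {a..b}" for t
    using noise[OF that] unfolding r_def by linarith+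
  \<comment> \<open>The share \<open>3 / 4\<close> of \<open>lam / t\<close> stays in the integrand
    and keeps its integral bounded uniformly in \<open>a\<close>.\<close>
  let ?\<phi> = "\<lambda>t. if t \<in> {a..b} then t powr (- 1 - \<kappa>) * exp (- (3 * lam / 4) / t) else 0"
  have \<phi>: "interval_weight ?\<phi> a b"
    using a_pos a_less_b lam by (intro interval_weight_continuous) (auto intro!: continuous_intros mult_pos_pos)
  have num: "(LINT t|lborel. weight \<epsilon> t * indicator A t)
      \<le> S * exp (- (5 + \<kappa>) * g) * hyperprior_bound \<kappa> (3 * lam / 4)"
  proof -
    have "weight \<epsilon> t * indicator A t \<le> S * exp (- (5 + \<kappa>) * g) * ?\<phi> t" for t
    proof (cases "t \<in> A \<and> t \<in> {a..b}")
      case True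
      then have t: "t > 0" "t \<in> {a..b}" using a_pos by auto
      have "D t \<ge> 0" using t D1L_nonneg[of t] D2L_nonneg[of t] by (simp add: DL_def)
      then have "- lam / t - r t / 2 \<le> - (5 + \<kappa>) * g - (3 * lam / 4) / t"
      proof -
        define u k where "u = lam / t" and "k = (5 + \<kappa>) * g"
        \<comment> \<open>The remaining quarter suffices:
          \<open>u / 4 + D t / 4 \<ge> (D t + 2 * u) / 8 \<ge> k\<close>.\<close>
        have "D t + 2 * u \<ge> 8 * k" using A(2)[of t] True by (simp add: u_def k_def algebra_simps)
        then have "- u - r t / 2 \<le> - k - 3 / 4 * u" using r(1)[OF t(2)] \<open>D t \<ge> 0\<close> by linarith
        then show ?thesis by (simp add: u_def k_def algebra_simps)
      qed
      then have "exp (- lam / t - r t / 2) \<le> exp (- (5 + \<kappa>) * g) * exp (- (3 * lam / 4) / t)"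
        by (simp add: exp_add[symmetric])
      then have "S * (t powr (- 1 - \<kappa>) * exp (- lam / t - r t / 2))
          \<le> S * (t powr (- 1 - \<kappa>) * (exp (- (5 + \<kappa>) * g) * exp (- (3 * lam / 4) / t)))"
        using S by (intro mult_left_mono) auto
      then show ?thesis using True w[OF t(2)] by (simp add: algebra_simps)
    next
      case False
      then have "weight \<epsilon> t * indicator A t = 0" using weight_eq by auto
      then show ?thesis using S by auto
    qed
    then have "(LINT t|lborel. weight \<epsilon> t * indicator A t) \<le> (LINT t|lborel. S * exp (- (5 + \<kappa>) * g) * ?\<phi> t)"
      using interval_weight.g_int[OF \<phi>] by (intro integral_mono post.int_restrict A) auto
    also have "\<dots> = S * exp (- (5 + \<kappa>) * g) * (LINT t|lborel. ?\<phi> t)" by simp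
    also have "\<dots> \<le> S * exp (- (5 + \<kappa>) * g) * hyperprior_bound \<kappa> (3 * lam / 4)"
      using S lam \<kappa> a_pos a_less_b by (intro mult_left_mono hyperprior_integral_le) auto
    finally show ?thesis .
  qed
  have c: "c > 0" using cn a_pos by simp
  have den: "(LINT t|lborel. weight \<epsilon> t) \<ge> S * (2 powr (- 1 - \<kappa>) * exp (- (4 + \<kappa>) * g))"
  proof -
    \<comment> \<open>With \<open>r t / 2 \<le> 3 / 4 * D t\<close> and \<open>D2L\<close> at most
      quadrupled, the exponent is at most the value at \<open>c\<close> of \<open>lam / c\<close>
      plus \<open>3 / 4\<close> of \<open>D1L\<close> plus three times \<open>D2L\<close>, well
      within \<open>4 * g\<close>.\<close>
    have lower: "weight \<epsilon> t \<ge> S * ((2 * c) powr (- 1 - \<kappa>) * exp (- 4 * g)) * indicator {c..2 * c} t" for t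
    proof (cases "t \<in> {c..2 * c}")
      case True
      then have t: "t \<in> {a..b}" "t > 0" using cn c by auto
      have "D1L x e \<mu> f n t \<le> D1L x e \<mu> f n c" using True c by (intro D1L_antimono) auto
      moreover have "D2L \<mu> n t \<le> 4 * D2L \<mu> n c"
        using D2L_mono[of t "2 * c"] D2L_double[of c] True c t by simp
      moreover have "lam / t \<le> lam / c" using True c lam by (intro divide_left_mono) auto
      moreover have "lam / t \<ge> 0" "D1L x e \<mu> f n c \<ge> 0" "D2L \<mu> n c \<ge> 0"
        using t lam D1L_nonneg D2L_nonneg c by auto
      ultimately have "lam / t + r t / 2 \<le> 4 * g"
        using r(2)[OF t(1)] g unfolding DL_def by simp
      then have "exp (- 4 * g) \<le> exp (- lam / t - r t / 2)" by simp
      moreover have "(2 * c) powr (- 1 - \<kappa>) \<le> t powr (- 1 - \<kappa>)"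
        using True t \<kappa> by (intro powr_mono2') auto
      ultimately have "S * ((2 * c) powr (- 1 - \<kappa>) * exp (- 4 * g))
          \<le> S * (t powr (- 1 - \<kappa>) * exp (- lam / t - r t / 2))"
        using S by (intro mult_left_mono mult_mono) auto
      then show ?thesis using w[OF t(1)] True by simp
    qed (simp add: post.g_nonneg)
    \<comment> \<open>Integrating over the length \<open>c\<close> turns the prior factor into a
      multiple of \<open>c powr (- \<kappa>)\<close>, which \<open>ln c \<le> g\<close> bounds below
      by \<open>exp (- \<kappa> * g)\<close>; this is the \<open>\<kappa>\<close> in the
      exponent.\<close>
    have "S * (2 powr (- 1 - \<kappa>) * exp (- (4 + \<kappa>) * g))
        \<le> S * ((2 * c) powr (- 1 - \<kappa>) * exp (- 4 * g)) * c"
    proof -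
      have "(2 * c) powr (- 1 - \<kappa>) * c = 2 powr (- 1 - \<kappa>) * exp (- \<kappa> * ln c)"
      proof -
        have "c powr (- 1 - \<kappa>) * c = c powr (- \<kappa>)"
          using c powr_add[of c "- 1 - \<kappa>" 1] by simp
        then show ?thesis using c by (simp add: powr_mult powr_def[of c "- \<kappa>"] mult.assoc)
      qed
      moreover have "exp (- \<kappa> * g) \<le> exp (- \<kappa> * ln c)" using ln_c \<kappa> by simp
      moreover have "exp (- (4 + \<kappa>) * g) = exp (- \<kappa> * g) * exp (- 4 * g)"
        by (simp add: exp_add[symmetric] algebra_simps)
      ultimately show ?thesis using S by (simp add: algebra_simps)
    qed
    also have "\<dots> = (LINT t|lborel. S * ((2 * c) powr (- 1 - \<kappa>) * exp (- 4 * g)) * indicator {c..2 * c} t)"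
      using c by simp
    also have "\<dots> \<le> (LINT t|lborel. weight \<epsilon> t)"
    proof (rule integral_mono[OF _ post.g_int lower])
      have "integrable lborel (indicator {c..2 * c} :: real \<Rightarrow> real)"
        by (rule integrable_real_indicator) (auto simp: emeasure_lborel_Icc_eq)
      then show "integrable lborel (\<lambda>t. S * ((2 * c) powr (- 1 - \<kappa>) * exp (- 4 * g)) * indicator {c..2 * c} t)"
        by simp
    qed
    finally show ?thesis .
  qed
  have "measure (post.law \<epsilon>) A \<le> (S * exp (- (5 + \<kappa>) * g) * hyperprior_bound \<kappa> (3 * lam / 4))
      / (S * (2 powr (- 1 - \<kappa>) * exp (- (4 + \<kappa>) * g)))"
    unfolding post.measure_law[OF A(1)] using num den S \<kappa>
    by (intro frac_le) (auto simp: hyperprior_bound_def)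
  also have "\<dots> = hyperprior_bound \<kappa> (3 * lam / 4) * 2 powr (1 + \<kappa>) * exp (- g)"
  proof -
    have "exp (- (5 + \<kappa>) * g) = exp (- (4 + \<kappa>) * g) * exp (- g)"
      by (simp add: exp_add[symmetric] algebra_simps)
    moreover have "(2 :: real) powr (1 + \<kappa>) * 2 powr (- 1 - \<kappa>) = 1"
      by (simp add: powr_add[symmetric])
    ultimately show ?thesis using S by (simp add: field_simps)
  qed
  finally show ?thesis .
qed

end

section \<open>Measurable events, suprema and diameters\<close>

lemma open_measurable_std_gaussian:
  assumes "open X"
  shows "{\<epsilon> \<in> space (std_gaussian n). \<epsilon> \<in> X} \<in> sets (std_gaussian n)"
proof -
  have "(\<lambda>\<epsilon>. \<epsilon>) \<in> measurable (std_gaussian n) (PiM UNIV (\<lambda>_::nat. borel :: real measure))"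
  proof (rule measurable_PiM_single')
    fix i :: nat
    show "(\<lambda>\<epsilon>. \<epsilon> i) \<in> borel_measurable (std_gaussian n)"
    proof (cases "i < n")
      case False
      then have "\<epsilon> i = undefined" if "\<epsilon> \<in> space (std_gaussian n)" for \<epsilon>
        using that by (auto simp: space_std_gaussian PiE_iff extensional_def)
      then have "(\<lambda>\<epsilon>. \<epsilon> i) \<in> borel_measurable (std_gaussian n)
          \<longleftrightarrow> (\<lambda>_. undefined :: real) \<in> borel_measurable (std_gaussian n)"
        by (rule measurable_cong)
      then show ?thesis by simp
    qed simp
  qed auto
  moreover have "X \<in> sets (PiM UNIV (\<lambda>_::nat. borel :: real measure))"
    using assms unfolding sets_PiM_equal_borel by simp
  ultimately have "(\<lambda>\<epsilon>. \<epsilon>) -` X \<inter> space (std_gaussian n) \<in> sets (std_gaussian n)"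
    by (rule measurable_sets)
  moreover have "(\<lambda>\<epsilon>. \<epsilon>) -` X \<inter> space (std_gaussian n) = {\<epsilon> \<in> space (std_gaussian n). \<epsilon> \<in> X}" by auto
  ultimately show ?thesis by simp
qed

text \<open>Continuity on a compact interval makes the supremum finite, so it really bounds the
  quotient. It exceeds \<open>\<delta>\<close> iff the quotient does at some \<open>t\<close>, which
  is a union over \<open>t\<close> of open conditions on the noise.\<close>

lemma sup_over_interval:
  fixes H :: "(nat \<Rightarrow> real) \<Rightarrow> real \<Rightarrow> real"
  assumes ab: "a \<le> b" and H: "\<And>\<epsilon>. continuous_on {a..b} (H \<epsilon>)" "\<And>t. continuous_on UNIV (\<lambda>\<epsilon>. H \<epsilon> t)"
    "\<And>\<epsilon> t. H \<epsilon> t \<ge> 0" and D: "continuous_on {a..b} D" "\<And>t. t \<in> {a..b} \<Longrightarrow> D t > 0"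
  shows "\<And>\<epsilon> t. t \<in> {a..b} \<Longrightarrow> \<bar>(SUP t\<in>{a..b}. H \<epsilon> t / D t) - 0\<bar> \<le> \<delta> \<Longrightarrow> H \<epsilon> t \<le> \<delta> * D t"
    and "{\<epsilon> \<in> space (std_gaussian n). \<bar>(SUP t\<in>{a..b}. H \<epsilon> t / D t) - 0\<bar> > \<delta>} \<in> sets (std_gaussian n)"
proof -
  have cont: "continuous_on {a..b} (\<lambda>t. H \<epsilon> t / D t)" for \<epsilon>
    using H D by (intro continuous_on_divide) force+
  have bdd: "bdd_above ((\<lambda>t. H \<epsilon> t / D t) ` {a..b})" for \<epsilon>
    using compact_continuous_image[OF cont] by (intro bounded_imp_bdd_above compact_imp_bounded) auto
  have upper: "H \<epsilon> t / D t \<le> (SUP t\<in>{a..b}. H \<epsilon> t / D t)" if "t \<in> {a..b}" for \<epsilon> t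
    using that bdd by (intro cSUP_upper) auto
  have nonneg: "0 \<le> (SUP t\<in>{a..b}. H \<epsilon> t / D t)" for \<epsilon>
    using upper[of a \<epsilon>] H(3)[of \<epsilon> a] D(2)[of a] ab by (auto intro: order_trans[rotated])
  show "H \<epsilon> t \<le> \<delta> * D t" if "t \<in> {a..b}" "\<bar>(SUP t\<in>{a..b}. H \<epsilon> t / D t) - 0\<bar> \<le> \<delta>" for \<epsilon> t
  proof -
    have "H \<epsilon> t / D t \<le> \<delta>" using upper[OF that(1), of \<epsilon>] that(2) by linarith
    then show ?thesis using D(2)[OF that(1)] by (simp add: divide_le_eq)
  qed
  have "{\<epsilon> \<in> space (std_gaussian n). \<bar>(SUP t\<in>{a..b}. H \<epsilon> t / D t) - 0\<bar> > \<delta>}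
      = {\<epsilon> \<in> space (std_gaussian n). \<epsilon> \<in> (\<Union>t\<in>{a..b}. {\<epsilon>. \<delta> * D t < H \<epsilon> t})}"
  proof -
    have "\<bar>(SUP t\<in>{a..b}. H \<epsilon> t / D t) - 0\<bar> > \<delta> \<longleftrightarrow> (\<exists>t\<in>{a..b}. \<delta> * D t < H \<epsilon> t)" for \<epsilon>
    proof -
      have "\<bar>(SUP t\<in>{a..b}. H \<epsilon> t / D t) - 0\<bar> > \<delta> \<longleftrightarrow> \<delta> < (SUP t\<in>{a..b}. H \<epsilon> t / D t)"
        using nonneg[of \<epsilon>] by simp
      also have "\<dots> \<longleftrightarrow> (\<exists>t\<in>{a..b}. \<delta> < H \<epsilon> t / D t)"
        using ab bdd by (intro less_cSUP_iff) auto
      also have "\<dots> \<longleftrightarrow> (\<exists>t\<in>{a..b}. \<delta> * D t < H \<epsilon> t)"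
        using D(2) by (intro bex_cong) (auto simp: less_divide_eq)
      finally show ?thesis .
    qed
    then show ?thesis by blast
  qed
  also have "\<dots> \<in> sets (std_gaussian n)"
    by (intro open_measurable_std_gaussian open_UN ballI open_Collect_less H continuous_intros)
  finally show "{\<epsilon> \<in> space (std_gaussian n). \<bar>(SUP t\<in>{a..b}. H \<epsilon> t / D t) - 0\<bar> > \<delta>} \<in> sets (std_gaussian n)" .
qed

text \<open>\<open>R\<close> witnesses that the \<open>SUP\<close> is a genuine supremum; the empty
  set is covered by the default value 0.\<close>

lemma design_diameter_bounds:
  assumes bound: "\<And>v w. v \<in> S \<Longrightarrow> w \<in> S \<Longrightarrow> vnorm (design_vec x v n - design_vec x w n) \<le> R"
  shows "0 \<le> design_diameter x n S"
    and "0 \<le> r \<Longrightarrow> design_diameter x n S \<le> r \<longleftrightarrow>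
      (\<forall>v\<in>S. \<forall>w\<in>S. vnorm (design_vec x v n - design_vec x w n) \<le> r)"
proof -
  have bdd: "bdd_above ((\<lambda>(v, w). vnorm (design_vec x v n - design_vec x w n)) ` (S \<times> S))"
    using bound by (intro bdd_aboveI[of _ R]) auto
  have iff: "design_diameter x n S \<le> r \<longleftrightarrow>
      (\<forall>v\<in>S. \<forall>w\<in>S. vnorm (design_vec x v n - design_vec x w n) \<le> r)" if "S \<noteq> {}" for r
    unfolding design_diameter_def using that bdd by (subst if_not_P) (auto simp: cSUP_le_iff)
  show "0 \<le> design_diameter x n S"
  proof (cases "S = {}")
    case False
    then obtain v where "v \<in> S" by blast
    then show ?thesis
      using iff[OF False, of "design_diameter x n S"] order_trans[OF vnorm_nonneg] by blast
  qed (simp add: design_diameter_def)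
  show "0 \<le> r \<Longrightarrow> design_diameter x n S \<le> r \<longleftrightarrow>
      (\<forall>v\<in>S. \<forall>w\<in>S. vnorm (design_vec x v n - design_vec x w n) \<le> r)"
    using iff by (cases "S = {}") (auto simp: design_diameter_def)
qed

text \<open>The estimator multiplies every eigencoordinate by a factor between 0 and 1, whatever the
  scale.\<close>

lemma (in regression) vnorm_fhat_le:
  assumes c: "c \<ge> 0"
  shows "vnorm (fhat n U c (Y \<epsilon>)) \<le> vnorm (Y \<epsilon>)"
proof -
  have "(vnorm (fhat n U c (Y \<epsilon>)))\<^sup>2 = (\<Sum>j<n. (c * \<mu> n j / (1 + c * \<mu> n j) * (Y \<epsilon> \<bullet> e n j))\<^sup>2)"
    using vnorm_square[OF fhat_carrier[OF c \<mu>_nonneg]] fhat_coef[OF c \<mu>_nonneg Y_carrier]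
    by (simp cong: sum.cong_simp)
  also have "\<dots> \<le> (\<Sum>j<n. (Y \<epsilon> \<bullet> e n j)\<^sup>2)"
  proof (rule sum_mono)
    fix j assume "j \<in> {..<n}"
    then have "0 \<le> c * \<mu> n j / (1 + c * \<mu> n j)" "c * \<mu> n j / (1 + c * \<mu> n j) \<le> 1"
      using c \<mu>_nonneg[of j] denom_pos[OF c, of j] by (auto simp: divide_le_eq)
    then have "(c * \<mu> n j / (1 + c * \<mu> n j))\<^sup>2 \<le> 1" by (simp add: power_le_one)
    then show "(c * \<mu> n j / (1 + c * \<mu> n j) * (Y \<epsilon> \<bullet> e n j))\<^sup>2 \<le> (Y \<epsilon> \<bullet> e n j)\<^sup>2"
      unfolding power_mult_distrib by (intro mult_left_le_one_le) auto
  qed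
  also have "\<dots> = (vnorm (Y \<epsilon>))\<^sup>2" by (rule vnorm_square[symmetric]) simp
  finally show ?thesis using vnorm_nonneg power2_le_imp_le by blast
qed

lemma (in regression) distance_fhat_continuous:
  assumes c: "c \<ge> 0"
  shows "continuous_on UNIV (\<lambda>\<epsilon>. vnorm (design_vec x w n - fhat n U c (Y \<epsilon>)))"
proof -
  have car: "fhat n U c (Y \<epsilon>) \<in> carrier_vec n" for \<epsilon>
    using fhat_carrier[OF c \<mu>_nonneg] by simp
  have coef: "(design_vec x w n - fhat n U c (Y \<epsilon>)) \<bullet> e n j
      = design_vec x w n \<bullet> e n j - c * \<mu> n j / (1 + c * \<mu> n j) * (fj j + Z \<epsilon> j)" if "j < n" for \<epsilon> j
    using that minus_scalar_prod_distrib[OF design_vec_carrier car, of "e n j" w \<epsilon>]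
      fhat_coef[OF c \<mu>_nonneg Y_carrier, of j \<epsilon>] by (simp add: Y_coef)
  have "vnorm (design_vec x w n - fhat n U c (Y \<epsilon>))
      = sqrt (\<Sum>j<n. (design_vec x w n \<bullet> e n j - c * \<mu> n j / (1 + c * \<mu> n j) * (fj j + Z \<epsilon> j))\<^sup>2)" for \<epsilon>
    using vnorm_square[of "design_vec x w n - fhat n U c (Y \<epsilon>)"] car[of \<epsilon>] vnorm_nonneg
    by (intro real_sqrt_unique[symmetric]) (auto simp: coef cong: sum.cong_simp)
  moreover have "1 + c * \<mu> n j \<noteq> 0" if "j < n" for j
    using denom_pos[OF c that] by simp
  ultimately show ?thesis by (auto intro!: continuous_intros Z_continuous)
qed

section \<open>The scales between the quantiles and the credible set\<close>

context hierarchical_bayes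
begin

text \<open>If \<open>D t + 2 * lam / t\<close> is too large, it is still large on the whole tail
  from \<open>t\<close> away from \<open>c\<close>. That tail then has too little mass for
  \<open>t\<close> to lie between the quantiles.\<close>

lemma quantile_range_criterion:
  assumes p: "0 < p\<^sub>1" "p\<^sub>1 < p\<^sub>2" "p\<^sub>2 < 1"
    and cn: "c \<in> {a..b}" "2 * c \<in> {a..b}" and ln_c: "ln c \<le> g"
    and g: "D c + 2 * lam / c \<le> g"
    and noise: "\<And>t. t \<in> {a..b} \<Longrightarrow> \<bar>R1L x e \<mu> f n \<epsilon> t\<bar> + \<bar>R2L e \<mu> n \<epsilon> t\<bar> \<le> D t / 2"
    and small: "hyperprior_bound \<kappa> (3 * lam / 4) * 2 powr (1 + \<kappa>) * exp (- g) < min p\<^sub>1 (1 - p\<^sub>2)"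
    and t: "t \<in> {quantile (post.law \<epsilon>) p\<^sub>1 <..< quantile (post.law \<epsilon>) p\<^sub>2}"
  shows "t \<in> {a..b}" "D t + 2 * lam / t \<le> (8 * (5 + \<kappa>) + 1) * g"
proof -
  have F: "p\<^sub>1 < cdf (post.law \<epsilon>) t" "cdf (post.law \<epsilon>) t < p\<^sub>2"
    using t post.quantile_interval[OF p] by auto
  have "a < t" "t < b" using F p by (intro post.between_quantiles_range[of \<epsilon>]; simp)+
  then show tI: "t \<in> {a..b}" by simp
  note tail = posterior_tail[OF cn ln_c g noise]
  have pos: "c > 0" "t > 0" using cn tI a_pos by auto
  have nn: "D1L x e \<mu> f n c \<ge> 0" "D2L \<mu> n c \<ge> 0" "2 * lam / c \<ge> 0"
    using D1L_nonneg D2L_nonneg pos lam by auto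
  show "D t + 2 * lam / t \<le> (8 * (5 + \<kappa>) + 1) * g"
  proof (rule ccontr)
    assume "\<not> D t + 2 * lam / t \<le> (8 * (5 + \<kappa>) + 1) * g"
    \<comment> \<open>The spare \<open>g\<close> pays for the terms that do not grow from
      \<open>c\<close> to \<open>t\<close>: they are at most their values at \<open>c\<close>, hence
      at most \<open>g\<close>. The growing terms alone exceed the threshold and keep growing beyond
      \<open>t\<close>.\<close>
    then have big: "D t + 2 * lam / t > 8 * (5 + \<kappa>) * g + g" by (simp add: algebra_simps)
    show False
    proof (cases "c \<le> t")
      case True
      have "measure (post.law \<epsilon>) {t<..} \<le> hyperprior_bound \<kappa> (3 * lam / 4) * 2 powr (1 + \<kappa>) * exp (- g)"
      proof (rule tail)
        fix s assume "s \<in> {t<..}" "s \<in> {a..b}"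
        then have s: "t \<le> s" by simp
        have "D2L \<mu> n t \<le> D2L \<mu> n s" using s pos by (intro D2L_mono) auto
        moreover have "D1L x e \<mu> f n t \<le> D1L x e \<mu> f n c" using True pos by (intro D1L_antimono) auto
        moreover have "2 * lam / t \<le> 2 * lam / c" using True pos lam by (intro divide_left_mono) auto
        moreover have "D1L x e \<mu> f n s \<ge> 0" "2 * lam / s \<ge> 0" using s pos lam D1L_nonneg[of s] by auto
        ultimately show "8 * (5 + \<kappa>) * g \<le> D s + 2 * lam / s" using big g nn unfolding DL_def by linarith
      qed auto
      moreover have "measure (post.law \<epsilon>) {t<..} = 1 - cdf (post.law \<epsilon>) t"
      proof -
        have "{t<..} = space (post.law \<epsilon>) - {..t}" by auto
        then show ?thesis using post.law.prob_compl[of "{..t}" \<epsilon>] by (simp add: cdf_def)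
      qed
      ultimately show False using small F by simp
    next
      case False
      have "measure (post.law \<epsilon>) {..t} \<le> hyperprior_bound \<kappa> (3 * lam / 4) * 2 powr (1 + \<kappa>) * exp (- g)"
      proof (rule tail)
        fix s assume "s \<in> {..t}" "s \<in> {a..b}"
        then have s: "s \<le> t" "s > 0" using a_pos by auto
        have "D2L \<mu> n t \<le> D2L \<mu> n c" using False pos by (intro D2L_mono) auto
        moreover have "D1L x e \<mu> f n t \<le> D1L x e \<mu> f n s" using s by (intro D1L_antimono) auto
        moreover have "2 * lam / t \<le> 2 * lam / s" using s lam by (intro divide_left_mono) auto
        moreover have "D2L \<mu> n s \<ge> 0" using s D2L_nonneg[of s] by auto
        ultimately show "8 * (5 + \<kappa>) * g \<le> D s + 2 * lam / s" using big g nn unfolding DL_def by linarith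
      qed auto
      then show False using small F by (simp add: cdf_def)
    qed
  qed
qed

abbreviation credible_set :: "real \<Rightarrow> real \<Rightarrow> real \<Rightarrow> real \<Rightarrow> (nat \<Rightarrow> real) \<Rightarrow> ('x \<Rightarrow> real) set" where
  "credible_set p\<^sub>1 p\<^sub>2 \<eta> M \<epsilon> \<equiv> hb_credible_set m \<kappa> lam p\<^sub>1 p\<^sub>2 \<eta> M x n U (Y \<epsilon>)"

text \<open>For fixed \<open>w\<close> the noise enters through the distribution function and the
  centre only; the radius is deterministic. Restricting \<open>t\<close> to \<open>{a..b}\<close>
  loses nothing, since the distribution function is 0 or 1 elsewhere.\<close>

lemma mem_credible_set:
  assumes p: "0 < p\<^sub>1" "p\<^sub>1 < p\<^sub>2" "p\<^sub>2 < 1"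
  shows "w \<in> credible_set p\<^sub>1 p\<^sub>2 \<eta> M \<epsilon> \<longleftrightarrow>
    (\<exists>t\<in>{a..b}. p\<^sub>1 < cdf (post.law \<epsilon>) t \<and> cdf (post.law \<epsilon>) t < p\<^sub>2
      \<and> vnorm (design_vec x w n - fhat n U t (Y \<epsilon>)) < M * radius n U t \<eta>)"
proof -
  have "a < t \<and> t < b" if "p\<^sub>1 < cdf (post.law \<epsilon>) t" "cdf (post.law \<epsilon>) t < p\<^sub>2" for t
    using post.between_quantiles_range[of \<epsilon> t] that p by auto
  then show ?thesis
    unfolding hb_credible_set_def Let_def posterior_law post.quantile_interval[OF p] by fastforce
qed

lemma open_mem_credible_set:
  assumes p: "0 < p\<^sub>1" "p\<^sub>1 < p\<^sub>2" "p\<^sub>2 < 1"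
  shows "open {\<epsilon>. w \<in> credible_set p\<^sub>1 p\<^sub>2 \<eta> M \<epsilon>}"
proof -
  have "{\<epsilon>. w \<in> credible_set p\<^sub>1 p\<^sub>2 \<eta> M \<epsilon>} = (\<Union>t\<in>{a..b}. {\<epsilon>. p\<^sub>1 < cdf (post.law \<epsilon>) t}
      \<inter> {\<epsilon>. cdf (post.law \<epsilon>) t < p\<^sub>2} \<inter> {\<epsilon>. vnorm (design_vec x w n - fhat n U t (Y \<epsilon>)) < M * radius n U t \<eta>})"
    unfolding mem_credible_set[OF p] by auto
  also have "open \<dots>"
    using a_pos
    by (intro open_UN ballI open_Int open_Collect_less cdf_posterior_continuous continuous_on_const
        distance_fhat_continuous) auto
  finally show ?thesis .
qed

text \<open>The reference point \<open>u\<close> is left free: the origin serves a crude bound valid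
  for every noise, the true function the sharp bound on the good event.\<close>

lemma credible_set_distance:
  assumes p: "0 < p\<^sub>1" "p\<^sub>1 < p\<^sub>2" "p\<^sub>2 < 1" and u: "u \<in> carrier_vec n"
    and bound: "\<And>t. t \<in> {quantile (post.law \<epsilon>) p\<^sub>1 <..< quantile (post.law \<epsilon>) p\<^sub>2} \<Longrightarrow> t \<in> {a..b} \<Longrightarrow>
      vnorm (u - fhat n U t (Y \<epsilon>)) + M * radius n U t \<eta> \<le> \<rho>"
    and vw: "v \<in> credible_set p\<^sub>1 p\<^sub>2 \<eta> M \<epsilon>" "w \<in> credible_set p\<^sub>1 p\<^sub>2 \<eta> M \<epsilon>"
  shows "vnorm (design_vec x v n - design_vec x w n) \<le> 2 * \<rho>"
proof -
  have dist: "vnorm (design_vec x w n - u) \<le> \<rho>" if w: "w \<in> credible_set p\<^sub>1 p\<^sub>2 \<eta> M \<epsilon>" for w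
  proof -
    obtain t where t: "t \<in> {a..b}" "p\<^sub>1 < cdf (post.law \<epsilon>) t" "cdf (post.law \<epsilon>) t < p\<^sub>2"
      "vnorm (design_vec x w n - fhat n U t (Y \<epsilon>)) < M * radius n U t \<eta>"
      using w unfolding mem_credible_set[OF p] by blast
    have car: "fhat n U t (Y \<epsilon>) \<in> carrier_vec n"
      using fhat_carrier[of t "Y \<epsilon>"] \<mu>_nonneg t(1) a_pos by auto
    have "vnorm (design_vec x w n - u)
        \<le> vnorm (design_vec x w n - fhat n U t (Y \<epsilon>)) + vnorm (fhat n U t (Y \<epsilon>) - u)"
      by (rule vnorm_triangle[OF _ car u]) simp
    also have "vnorm (fhat n U t (Y \<epsilon>) - u) = vnorm (u - fhat n U t (Y \<epsilon>))"
      by (rule vnorm_minus_commute[OF car u])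
    finally show ?thesis
      using t bound[of t] post.quantile_interval[OF p, of \<epsilon>] by auto
  qed
  have "vnorm (design_vec x v n - design_vec x w n)
      \<le> vnorm (design_vec x v n - u) + vnorm (u - design_vec x w n)"
    by (rule vnorm_triangle[OF _ u]) auto
  also have "vnorm (u - design_vec x w n) = vnorm (design_vec x w n - u)"
    by (rule vnorm_minus_commute[OF u]) simp
  finally show ?thesis using dist[OF vw(1)] dist[OF vw(2)] by simp
qed

text \<open>Only finiteness matters, so the bound may depend on the noise. It is uniform in the
  scale because \<open>fhat\<close> does not lengthen the observation and \<open>s2\<close> is at
  most \<open>n\<close>.\<close>

lemma credible_set_bounded:
  assumes p: "0 < p\<^sub>1" "p\<^sub>1 < p\<^sub>2" "p\<^sub>2 < 1" and \<eta>: "0 < \<eta>" "\<eta> < 1" and M: "M > 0"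
    and s2: "\<And>t. t \<in> {a..b} \<Longrightarrow> s2 \<mu> n t > 0"
    and vw: "v \<in> credible_set p\<^sub>1 p\<^sub>2 \<eta> M \<epsilon>" "w \<in> credible_set p\<^sub>1 p\<^sub>2 \<eta> M \<epsilon>"
  shows "vnorm (design_vec x v n - design_vec x w n) \<le> 2 * (vnorm (Y \<epsilon>) + M * sqrt (n / (1 - \<eta>)))"
proof (rule credible_set_distance[OF p _ _ vw])
  show "0\<^sub>v n \<in> carrier_vec n" by simp
  fix t assume t: "t \<in> {a..b}"
  then have t0: "t \<ge> 0" using a_pos by simp
  have car: "fhat n U t (Y \<epsilon>) \<in> carrier_vec n"
    using fhat_carrier[of t "Y \<epsilon>"] \<mu>_nonneg t0 by auto
  have "fhat n U t (Y \<epsilon>) - 0\<^sub>v n = fhat n U t (Y \<epsilon>)" using car by (intro eq_vecI) auto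
  then have "vnorm (0\<^sub>v n - fhat n U t (Y \<epsilon>)) = vnorm (fhat n U t (Y \<epsilon>))"
    using vnorm_minus_commute[OF zero_carrier_vec car] by simp
  moreover have "radius n U t \<eta> \<le> sqrt (n / (1 - \<eta>))"
  proof -
    have "(radius n U t \<eta>)\<^sup>2 \<le> n / (1 - \<eta>)"
      using radius_square_le_s2[OF t0 s2[OF t] \<eta>] s2_le[OF t0] \<eta> 
      by (smt (verit) divide_right_mono)
    then show ?thesis by (rule real_le_rsqrt)
  qed
  ultimately show "vnorm (0\<^sub>v n - fhat n U t (Y \<epsilon>)) + M * radius n U t \<eta> \<le> vnorm (Y \<epsilon>) + M * sqrt (n / (1 - \<eta>))"
    using vnorm_fhat_le[OF t0, of \<epsilon>] M by (intro add_mono mult_left_mono) auto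
qed

text \<open>The complement is the union, over pairs at distance more than \<open>sqrt r\<close>, of
  the open sets of noises for which both functions are members.\<close>

lemma diameter_event_measurable:
  assumes p: "0 < p\<^sub>1" "p\<^sub>1 < p\<^sub>2" "p\<^sub>2 < 1" and \<eta>: "0 < \<eta>" "\<eta> < 1" and M: "M > 0"
    and s2: "\<And>t. t \<in> {a..b} \<Longrightarrow> s2 \<mu> n t > 0" and r: "r \<ge> 0"
  shows "{\<epsilon> \<in> space (std_gaussian n). (design_diameter x n (credible_set p\<^sub>1 p\<^sub>2 \<eta> M \<epsilon>))\<^sup>2 \<le> r} \<in> sets (std_gaussian n)"
proof -
  let ?C = "credible_set p\<^sub>1 p\<^sub>2 \<eta> M"
  define V where "V = {(v, w). vnorm (design_vec x v n - design_vec x w n) > sqrt r}"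
  have iff: "(design_diameter x n (?C \<epsilon>))\<^sup>2 \<le> r \<longleftrightarrow> \<not> (\<exists>(v, w)\<in>V. v \<in> ?C \<epsilon> \<and> w \<in> ?C \<epsilon>)" for \<epsilon>
  proof -
    note bdd = credible_set_bounded[OF p \<eta> M s2, where \<epsilon> = \<epsilon>]
    have nonneg: "0 \<le> design_diameter x n (?C \<epsilon>)"
      by (rule design_diameter_bounds(1)) (rule bdd)
    have "(design_diameter x n (?C \<epsilon>))\<^sup>2 \<le> r \<longleftrightarrow> design_diameter x n (?C \<epsilon>) \<le> sqrt r"
      using nonneg by (metis abs_of_nonneg real_sqrt_abs real_sqrt_le_iff)
    also have "\<dots> \<longleftrightarrow> (\<forall>v\<in>?C \<epsilon>. \<forall>w\<in>?C \<epsilon>. vnorm (design_vec x v n - design_vec x w n) \<le> sqrt r)"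
      using r by (intro design_diameter_bounds(2)[OF bdd]) auto
    finally show ?thesis unfolding V_def by (auto simp: not_less)
  qed
  have "{\<epsilon> \<in> space (std_gaussian n). \<epsilon> \<in> (\<Union>(v, w)\<in>V. {\<epsilon>. v \<in> ?C \<epsilon>} \<inter> {\<epsilon>. w \<in> ?C \<epsilon>})} \<in> sets (std_gaussian n)"
    using open_mem_credible_set[OF p] by (intro open_measurable_std_gaussian open_UN) auto
  then have "space (std_gaussian n) - {\<epsilon> \<in> space (std_gaussian n). \<epsilon> \<in> (\<Union>(v, w)\<in>V. {\<epsilon>. v \<in> ?C \<epsilon>} \<inter> {\<epsilon>. w \<in> ?C \<epsilon>})}
      \<in> sets (std_gaussian n)" by auto
  also have "space (std_gaussian n) - {\<epsilon> \<in> space (std_gaussian n). \<epsilon> \<in> (\<Union>(v, w)\<in>V. {\<epsilon>. v \<in> ?C \<epsilon>} \<inter> {\<epsilon>. w \<in> ?C \<epsilon>})}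
      = {\<epsilon> \<in> space (std_gaussian n). (design_diameter x n (?C \<epsilon>))\<^sup>2 \<le> r}"
    unfolding iff by auto
  finally show ?thesis .
qed

end

section \<open>Probability bound for the diameter and passage to the limit\<close>

text \<open>In \<open>K\<close>, the 4 squares the factor 2 between radius and diameter. In
  \<open>2 + K\<^sub>1\<close>, one unit is \<open>D\<close> itself, one its bound on
  \<open>R3\<close> and \<open>R4\<close>, and \<open>K\<^sub>1\<close> comes from
  \<open>D2R\<close>. The summand with \<open>M\<close> is the radius, via Markov and
  \<open>s2 \<le> D2L / k\<close>. The factor with \<open>\<kappa>\<close> is that of
  \<open>quantile_range_criterion\<close>, and \<open>max 1 (2 * lam)\<close> adjusts the
  penalty.\<close>

lemma (in hierarchical_bayes) credible_diameter_probability: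
  fixes p\<^sub>1 p\<^sub>2 \<eta> M k K\<^sub>1 c g :: real
  defines "K \<equiv> 4 * (sqrt (2 + K\<^sub>1) + M / sqrt (k * (1 - \<eta>)))\<^sup>2 * (8 * (5 + \<kappa>) + 1) * max 1 (2 * lam)"
  assumes p: "0 < p\<^sub>1" "p\<^sub>1 < p\<^sub>2" "p\<^sub>2 < 1" and \<eta>: "0 < \<eta>" "\<eta> < 1" and M: "M > 0"
    and K\<^sub>1: "K\<^sub>1 \<ge> 0" and k: "k > 0"
    and D_pos: "\<And>t. t \<in> {a..b} \<Longrightarrow> D t > 0"
    and D2R_le: "\<And>t. t \<in> {a..b} \<Longrightarrow> D2R \<mu> n t \<le> K\<^sub>1 * D2L \<mu> n t"
    and s2_pos: "\<And>t. t \<in> {a..b} \<Longrightarrow> s2 \<mu> n t > 0"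
    and s2_le: "\<And>t. t \<in> {a..b} \<Longrightarrow> k * s2 \<mu> n t \<le> D2L \<mu> n t"
    and cn: "c \<in> {a..b}" "2 * c \<in> {a..b}" and ln_c: "ln c \<le> g"
    and g: "D c + 2 * lam / c = g" and min: "\<And>t. t \<in> {a..b} \<Longrightarrow> g \<le> D t + 2 * lam / t"
    and small: "hyperprior_bound \<kappa> (3 * lam / 4) * 2 powr (1 + \<kappa>) * exp (- g) < min p\<^sub>1 (1 - p\<^sub>2)"
  shows "measure (std_gaussian n) {\<epsilon> \<in> space (std_gaussian n).
      (design_diameter x n (credible_set p\<^sub>1 p\<^sub>2 \<eta> M \<epsilon>))\<^sup>2 \<le> K * (INF t\<in>{a..b}. D t + 1 / t)}
    \<ge> 1 - measure (std_gaussian n) {\<epsilon> \<in> space (std_gaussian n).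
          \<bar>(SUP t\<in>{a..b}. (\<bar>R1L x e \<mu> f n \<epsilon> t\<bar> + \<bar>R2L e \<mu> n \<epsilon> t\<bar>) / D t) - 0\<bar> > 1 / 2}
        - measure (std_gaussian n) {\<epsilon> \<in> space (std_gaussian n).
          \<bar>(SUP t\<in>{a..b}. (\<bar>R3 x e \<mu> f n \<epsilon> t\<bar> + \<bar>R4 e \<mu> n \<epsilon> t\<bar>) / D t) - 0\<bar> > 1}"
    (is "measure ?P ?A \<ge> 1 - measure ?P ?B\<^sub>1 - measure ?P ?B\<^sub>2")
proof -
  interpret P: prob_space ?P by (rule prob_space_std_gaussian)
  let ?C = "credible_set p\<^sub>1 p\<^sub>2 \<eta> M"
  have nonneg: "{a..b} \<subseteq> {0..}" using a_pos by auto
  have R12: "continuous_on {a..b} (\<lambda>t. \<bar>R1L x e \<mu> f n \<epsilon> t\<bar> + \<bar>R2L e \<mu> n \<epsilon> t\<bar>)"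
      "continuous_on UNIV (\<lambda>\<epsilon>. \<bar>R1L x e \<mu> f n \<epsilon> t\<bar> + \<bar>R2L e \<mu> n \<epsilon> t\<bar>)"
    and R34: "continuous_on {a..b} (\<lambda>t. \<bar>R3 x e \<mu> f n \<epsilon> t\<bar> + \<bar>R4 e \<mu> n \<epsilon> t\<bar>)"
      "continuous_on UNIV (\<lambda>\<epsilon>. \<bar>R3 x e \<mu> f n \<epsilon> t\<bar> + \<bar>R4 e \<mu> n \<epsilon> t\<bar>)" for \<epsilon> t
    by (intro continuous_intros terms_continuous[OF nonneg] noise_terms_continuous)+
  note sup12 = sup_over_interval[of a b "\<lambda>\<epsilon> t. \<bar>R1L x e \<mu> f n \<epsilon> t\<bar> + \<bar>R2L e \<mu> n \<epsilon> t\<bar>" D,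
      OF less_imp_le[OF a_less_b] R12 _ terms_continuous(1)[OF nonneg] D_pos]
  note sup34 = sup_over_interval[of a b "\<lambda>\<epsilon> t. \<bar>R3 x e \<mu> f n \<epsilon> t\<bar> + \<bar>R4 e \<mu> n \<epsilon> t\<bar>" D,
      OF less_imp_le[OF a_less_b] R34 _ terms_continuous(1)[OF nonneg] D_pos]
  have B: "?B\<^sub>1 \<in> sets ?P" "?B\<^sub>2 \<in> sets ?P"
    by (rule sup12(2) sup34(2); simp)+
  \<comment> \<open>Exchanges the penalty \<open>2 * lam / t\<close> of the minimized function for
    the \<open>1 / t\<close> of the claim.\<close>
  have INF: "g \<le> max 1 (2 * lam) * (INF t\<in>{a..b}. D t + 1 / t)"
  proof -
    have "g / max 1 (2 * lam) \<le> (INF t\<in>{a..b}. D t + 1 / t)"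
    proof (rule cINF_greatest)
      fix t assume t: "t \<in> {a..b}"
      then have "t > 0" using a_pos by simp
      have "g \<le> 1 * D t + (2 * lam) * (1 / t)" using min[OF t] by simp
      also have "\<dots> \<le> max 1 (2 * lam) * D t + max 1 (2 * lam) * (1 / t)"
        using D_pos[OF t] \<open>t > 0\<close> by (intro add_mono mult_right_mono) auto
      finally show "g / max 1 (2 * lam) \<le> D t + 1 / t"
        by (subst pos_divide_le_eq) (auto simp: algebra_simps)
    qed (use a_less_b in simp)
    then show ?thesis by (subst (asm) pos_divide_le_eq) (auto simp: algebra_simps)
  qed
  have g0: "g > 0" using g D_pos[OF cn(1)] cn a_pos lam by (auto intro!: add_pos_pos)
  have INF0: "(INF t\<in>{a..b}. D t + 1 / t) \<ge> 0"
    using INF g0 by (smt (verit) max.cobounded1 mult_le_0_iff)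
  have K0: "K \<ge> 0" unfolding K_def using \<kappa> by simp
  have A: "?A \<in> sets ?P"
    using K0 INF0 by (intro diameter_event_measurable p \<eta> M s2_pos) auto
  have good: "\<epsilon> \<in> ?A" if \<epsilon>: "\<epsilon> \<in> space ?P" "\<epsilon> \<notin> ?B\<^sub>1" "\<epsilon> \<notin> ?B\<^sub>2" for \<epsilon>
  proof -
    \<comment> \<open>Relative noise of at most one half keeps the deviance two-sided comparable
      with \<open>D\<close> up to its constant; for the error terms in \<open>noise'\<close> any
      fixed bound would do, and 1 is taken.\<close>
    have noise: "\<bar>R1L x e \<mu> f n \<epsilon> t\<bar> + \<bar>R2L e \<mu> n \<epsilon> t\<bar> \<le> D t / 2" if "t \<in> {a..b}" for t
      using sup12(1)[of t \<epsilon> "1 / 2"] that \<epsilon> by (simp add: not_less)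
    have noise': "\<bar>R3 x e \<mu> f n \<epsilon> t\<bar> + \<bar>R4 e \<mu> n \<epsilon> t\<bar> \<le> D t" if "t \<in> {a..b}" for t
      using sup34(1)[of t \<epsilon> 1] that \<epsilon> by (simp add: not_less)
    define G where "G = (8 * (5 + \<kappa>) + 1) * g"
    have G0: "G > 0" unfolding G_def using g0 \<kappa> by simp
    define \<rho> where "\<rho> = sqrt ((2 + K\<^sub>1) * G) + M * sqrt (G / (k * (1 - \<eta>)))"
    have dist: "vnorm (design_vec x v n - design_vec x w n) \<le> 2 * \<rho>" if vw: "v \<in> ?C \<epsilon>" "w \<in> ?C \<epsilon>" for v w
    proof (rule credible_set_distance[OF p _ _ vw])
      show "design_vec x f n \<in> carrier_vec n" by simp
      fix t assume q: "t \<in> {quantile (post.law \<epsilon>) p\<^sub>1 <..< quantile (post.law \<epsilon>) p\<^sub>2}" and t: "t \<in> {a..b}"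
      have t0: "t > 0" using t a_pos by simp
      have "D t + 2 * lam / t \<le> G"
        unfolding G_def using g q by (intro quantile_range_criterion(2)[OF p cn ln_c _ noise small]) auto
      moreover have "2 * lam / t \<ge> 0" using t0 lam by simp
      ultimately have DG: "D t \<le> G" by linarith
      have D1: "0 \<le> D1L x e \<mu> f n t" using t0 by (intro D1L_nonneg) simp
      have D2: "0 \<le> D2L \<mu> n t" using t0 by (intro D2L_nonneg) simp
      have "(vnorm (design_vec x f n - fhat n U t (Y \<epsilon>)))\<^sup>2 \<le> (2 + K\<^sub>1) * G"
      proof -
        have "(vnorm (design_vec x f n - fhat n U t (Y \<epsilon>)))\<^sup>2
            \<le> D1L x e \<mu> f n t + D2R \<mu> n t + R3 x e \<mu> f n \<epsilon> t + R4 e \<mu> n \<epsilon> t"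
          using t0 by (intro squared_error) simp
        also have "\<dots> \<le> D t + K\<^sub>1 * D2L \<mu> n t + D t"
          using D2R_le[OF t] noise'[OF t] D2 abs_ge_self[of "R3 x e \<mu> f n \<epsilon> t"] abs_ge_self[of "R4 e \<mu> n \<epsilon> t"]
          unfolding DL_def by linarith
        also have "\<dots> \<le> G + K\<^sub>1 * G + G"
          using DG D1 K\<^sub>1 by (intro add_mono mult_left_mono) (auto simp: DL_def)
        finally show ?thesis by (simp add: algebra_simps)
      qed
      moreover have "(radius n U t \<eta>)\<^sup>2 \<le> G / (k * (1 - \<eta>))"
      proof -
        have "s2 \<mu> n t \<le> G / k"
          using s2_le[OF t] DG D1 k by (simp add: DL_def pos_le_divide_eq mult.commute)
        then have "s2 \<mu> n t / (1 - \<eta>) \<le> G / k / (1 - \<eta>)" using \<eta> by (intro divide_right_mono) auto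
        then show ?thesis
          using radius_square_le_s2[OF less_imp_le[OF t0] s2_pos[OF t] \<eta>] by simp
      qed
      ultimately show "vnorm (design_vec x f n - fhat n U t (Y \<epsilon>)) + M * radius n U t \<eta> \<le> \<rho>"
        unfolding \<rho>_def using M by (intro add_mono mult_left_mono real_le_rsqrt) auto
    qed
    have "\<rho> \<ge> 0" unfolding \<rho>_def using M K\<^sub>1 G0 k \<eta> by simp
    then have "(design_diameter x n (?C \<epsilon>))\<^sup>2 \<le> (2 * \<rho>)\<^sup>2"
      using design_diameter_bounds(1)[OF dist] design_diameter_bounds(2)[OF dist, where r = "2 * \<rho>"] dist
      by (intro power_mono) auto
    also have "\<rho> = (sqrt (2 + K\<^sub>1) + M / sqrt (k * (1 - \<eta>))) * sqrt G"
      unfolding \<rho>_def real_sqrt_mult real_sqrt_divide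
      by (simp only: distrib_right times_divide_eq_left times_divide_eq_right)
    also have "(2 * \<dots>)\<^sup>2 = 4 * (sqrt (2 + K\<^sub>1) + M / sqrt (k * (1 - \<eta>)))\<^sup>2 * (8 * (5 + \<kappa>) + 1) * g"
      using G0 by (simp add: power_mult_distrib G_def)
    also have "\<dots> \<le> 4 * (sqrt (2 + K\<^sub>1) + M / sqrt (k * (1 - \<eta>)))\<^sup>2 * (8 * (5 + \<kappa>) + 1)
        * (max 1 (2 * lam) * (INF t\<in>{a..b}. D t + 1 / t))"
      using \<kappa> by (intro mult_left_mono INF) auto
    finally show ?thesis using \<epsilon> by (simp add: K_def mult.assoc)
  qed
  have "1 - measure ?P ?A = measure ?P (space ?P - ?A)" using P.prob_compl[OF A] by simp
  also have "\<dots> \<le> measure ?P (?B\<^sub>1 \<union> ?B\<^sub>2)"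
    using good B by (intro P.finite_measure_mono) blast+
  also have "\<dots> \<le> measure ?P ?B\<^sub>1 + measure ?P ?B\<^sub>2"
    by (rule measure_Un_le[OF B])
  finally show ?thesis by simp
qed

theorem theorem32:
  fixes \<Omega> :: "'w measure" and W :: "'x \<Rightarrow> 'w \<Rightarrow> real"
    and x :: "nat \<Rightarrow> nat \<Rightarrow> 'x" and f :: "'x \<Rightarrow> real"
    and e :: "nat \<Rightarrow> nat \<Rightarrow> real Matrix.vec" and \<mu> :: "nat \<Rightarrow> nat \<Rightarrow> real"
    and m \<kappa> lam M \<eta>\<^sub>1 \<eta>\<^sub>2 :: real and p\<^sub>1 p\<^sub>2 :: "real \<Rightarrow> real"
  assumes "centred_gaussian_process \<Omega> W"
    and "\<And>n. orthonormal_eigenbasis n (cov_mat \<Omega> W x n) (e n) (\<mu> n)"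
    and "m \<ge> 1" and "\<kappa> > 0" and "lam > 0" and "M > 0"
    and "0 < \<eta>\<^sub>1" and "\<eta>\<^sub>1 < 1" and "0 < \<eta>\<^sub>2" and "\<eta>\<^sub>2 < 1"
    and "0 < p\<^sub>1 \<eta>\<^sub>1" and "p\<^sub>1 \<eta>\<^sub>1 < p\<^sub>2 \<eta>\<^sub>1" and "p\<^sub>2 \<eta>\<^sub>1 < 1"
    and a1: "tendsto_in_prob std_gaussian
      (\<lambda>n \<epsilon>. SUP c\<in>scale_range m n.
        (\<bar>R1L x e \<mu> f n \<epsilon> c\<bar> + \<bar>R2L e \<mu> n \<epsilon> c\<bar>) / DL x e \<mu> f n c) 0"
    and a2: "tendsto_in_prob std_gaussian
      (\<lambda>n \<epsilon>. SUP c\<in>scale_range m n.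
        (\<bar>R3 x e \<mu> f n \<epsilon> c\<bar> + \<bar>R4 e \<mu> n \<epsilon> c\<bar>) / DL x e \<mu> f n c) 0"
    and b1: "good_variance_function (scale_range m) (D2L \<mu>)"
    and b2: "\<forall>\<^sub>F n in sequentially. \<forall>c\<in>scale_range m n. D2L \<mu> n c \<ge> ln (real n * c)"
    and c: "\<forall>\<^sub>F n in sequentially. \<exists>c\<^sub>n.
      is_arg_min (\<lambda>c. DL x e \<mu> f n c + 2 * lam / c) (\<lambda>c. c > 0) c\<^sub>n \<and>
      c\<^sub>n \<in> scale_range m n \<and> 2 * c\<^sub>n \<in> scale_range m n"
    and d1: "unif_asymp (scale_range m) (D2R \<mu>) (D2L \<mu>)"
    and d2: "unif_asymp (scale_range m) (D2L \<mu>) (s2 \<mu>)"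
  shows "\<exists>K>0. (\<lambda>n. measure (std_gaussian n)
      {\<epsilon> \<in> space (std_gaussian n).
        (design_diameter x n
          (hb_credible_set m \<kappa> lam (p\<^sub>1 \<eta>\<^sub>1) (p\<^sub>2 \<eta>\<^sub>1) \<eta>\<^sub>2 M x n
            (cov_mat \<Omega> W x n) (obs x f n \<epsilon>)))\<^sup>2
        \<le> K * (INF c\<in>scale_range m n. DL x e \<mu> f n c + 1 / c)}) \<longlonglongrightarrow> 1"
proof -
  \<comment> \<open>\<open>unif_asymp\<close> gives \<open>K\<^sub>1\<close> no sign; it is raised
    to \<open>max K\<^sub>1 0\<close> so that it may stand under the square root and multiply an
    upper bound.\<close>
  obtain k\<^sub>1 K\<^sub>1 where "\<forall>\<^sub>F n in sequentially. \<forall>t\<in>scale_range m n.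
      k\<^sub>1 \<le> D2R \<mu> n t / D2L \<mu> n t \<and> D2R \<mu> n t / D2L \<mu> n t \<le> K\<^sub>1"
    using d1 unfolding unif_asymp_def by blast
  then have ev_D2R: "\<forall>\<^sub>F n in sequentially. \<forall>t\<in>scale_range m n. D2R \<mu> n t / D2L \<mu> n t \<le> max K\<^sub>1 0"
    by eventually_elim (simp add: max.coboundedI1)
  obtain k k\<^sub>2 where k: "k > 0" and "\<forall>\<^sub>F n in sequentially. \<forall>t\<in>scale_range m n.
      k \<le> D2L \<mu> n t / s2 \<mu> n t \<and> D2L \<mu> n t / s2 \<mu> n t \<le> k\<^sub>2"
    using d2 unfolding unif_asymp_def by blast
  then have ev_s2: "\<forall>\<^sub>F n in sequentially. \<forall>t\<in>scale_range m n. k \<le> D2L \<mu> n t / s2 \<mu> n t"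
    by (auto elim: eventually_mono)
  define K where "K = 4 * (sqrt (2 + max K\<^sub>1 0) + M / sqrt (k * (1 - \<eta>\<^sub>2)))\<^sup>2 * (8 * (5 + \<kappa>) + 1) * max 1 (2 * lam)"
  have "sqrt (2 + max K\<^sub>1 0) + M / sqrt (k * (1 - \<eta>\<^sub>2)) > 0"
    using k assms by (intro add_pos_nonneg) auto
  then have K: "K > 0" unfolding K_def using \<open>\<kappa> > 0\<close> by (intro mult_pos_pos) auto
  define B where "B = hyperprior_bound \<kappa> (3 * lam / 4) * 2 powr (1 + \<kappa>)"
  have B: "B \<ge> 0" using \<open>\<kappa> > 0\<close> by (simp add: B_def hyperprior_bound_def)
  define \<delta> where "\<delta> = min (p\<^sub>1 \<eta>\<^sub>1) (1 - p\<^sub>2 \<eta>\<^sub>1)"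
  have \<delta>: "\<delta> > 0" using assms by (simp add: \<delta>_def)
  have ln_top: "filterlim (\<lambda>n. ln (real n)) at_top sequentially"
    by (intro filterlim_compose[OF ln_at_top] filterlim_real_sequentially)
  define H where "H n = measure (std_gaussian n) {\<epsilon> \<in> space (std_gaussian n). (design_diameter x n
      (hb_credible_set m \<kappa> lam (p\<^sub>1 \<eta>\<^sub>1) (p\<^sub>2 \<eta>\<^sub>1) \<eta>\<^sub>2 M x n (cov_mat \<Omega> W x n) (obs x f n \<epsilon>)))\<^sup>2
      \<le> K * (INF c\<in>scale_range m n. DL x e \<mu> f n c + 1 / c)}" for n
  define B\<^sub>1 where "B\<^sub>1 n = measure (std_gaussian n) {\<epsilon> \<in> space (std_gaussian n).
    \<bar>(SUP c\<in>scale_range m n. (\<bar>R1L x e \<mu> f n \<epsilon> c\<bar> + \<bar>R2L e \<mu> n \<epsilon> c\<bar>) / DL x e \<mu> f n c) - 0\<bar> > 1 / 2}" for n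
  define B\<^sub>2 where "B\<^sub>2 n = measure (std_gaussian n) {\<epsilon> \<in> space (std_gaussian n).
    \<bar>(SUP c\<in>scale_range m n. (\<bar>R3 x e \<mu> f n \<epsilon> c\<bar> + \<bar>R4 e \<mu> n \<epsilon> c\<bar>) / DL x e \<mu> f n c) - 0\<bar> > 1}" for n
  \<comment> \<open>The 1 forces \<open>n > 1\<close> and makes \<open>ln (ln (real n))\<close>
    positive; \<open>B / \<delta>\<close> brings the tail bound below both levels, as
    \<open>exp (- g) \<le> 1 / ln (real n)\<close>.\<close>
  have "\<forall>\<^sub>F n in sequentially. ln (real n) > max 1 (B / \<delta>)"
    using ln_top unfolding filterlim_at_top_dense by blast
  then have "\<forall>\<^sub>F n in sequentially. H n \<ge> 1 - B\<^sub>1 n - B\<^sub>2 n"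
    using ev_D2R ev_s2 b2 c
  proof eventually_elim
    fix n
    assume ln_n: "ln (real n) > max 1 (B / \<delta>)"
      and D2R: "\<forall>t\<in>scale_range m n. D2R \<mu> n t / D2L \<mu> n t \<le> max K\<^sub>1 0"
      and s2: "\<forall>t\<in>scale_range m n. k \<le> D2L \<mu> n t / s2 \<mu> n t"
      and D2L: "\<forall>t\<in>scale_range m n. D2L \<mu> n t \<ge> ln (real n * t)"
      and ex: "\<exists>c\<^sub>n. is_arg_min (\<lambda>c. DL x e \<mu> f n c + 2 * lam / c) (\<lambda>c. c > 0) c\<^sub>n \<and>
        c\<^sub>n \<in> scale_range m n \<and> 2 * c\<^sub>n \<in> scale_range m n"
    then obtain c\<^sub>n where min: "is_arg_min (\<lambda>c. DL x e \<mu> f n c + 2 * lam / c) (\<lambda>c. c > 0) c\<^sub>n"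
      and cn: "c\<^sub>n \<in> scale_range m n" "2 * c\<^sub>n \<in> scale_range m n" by blast
    have n: "real n > 1"
    proof (rule ccontr)
      assume "\<not> real n > 1"
      then have "n = 0 \<or> n = 1" by linarith
      then show False using ln_n by auto
    qed
    define a b where "a = ln (real n) / real n" and "b = real n powr (m - 1)"
    have a: "a > 0" using ln_n n by (simp add: a_def)
    have I: "scale_range m n = {a..b}" by (simp add: scale_range_def a_def b_def)
    have cn0: "c\<^sub>n > 0" using cn a by (simp add: I)
    interpret hierarchical_bayes n "cov_mat \<Omega> W x n" e \<mu> x f m \<kappa> lam a b
    proof unfold_locales
      show "\<mu> n j \<ge> 0" if "j < n" for j using eigenvalue_nonneg[OF assms(1,2) that] .
      show "a < b" using cn cn0 by (simp add: I)
    qed (use assms a I in \<open>auto simp: cov_mat_def\<close>)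
    \<comment> \<open>The left end \<open>ln (real n) / real n\<close> of the range gives
      \<open>real n * t \<ge> ln (real n)\<close>.\<close>
    have D2L_ge: "D2L \<mu> n t \<ge> ln (ln (real n))" if t: "t \<in> {a..b}" for t
    proof -
      have "ln (real n) \<le> real n * t" using t n by (simp add: a_def pos_divide_le_eq mult.commute)
      then have "ln (ln (real n)) \<le> ln (real n * t)" using ln_n by (intro ln_mono) auto
      also have "\<dots> \<le> D2L \<mu> n t" using D2L t I by blast
      finally show ?thesis .
    qed
    have lnln: "ln (ln (real n)) > 0" using ln_n by simp
    have D_ge: "D t \<ge> D2L \<mu> n t" if "t \<in> {a..b}" for t
      using D1L_nonneg[of t] that a by (simp add: DL_def)
    define g where "g = D c\<^sub>n + 2 * lam / c\<^sub>n"
    have g_ge: "g \<ge> D2L \<mu> n c\<^sub>n" using D_ge[of c\<^sub>n] cn I cn0 \<open>lam > 0\<close> by (simp add: g_def add_increasing2)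
    have small: "B * exp (- g) < \<delta>"
    proof -
      have "exp (- g) \<le> exp (- ln (ln (real n)))" using g_ge D2L_ge[of c\<^sub>n] cn I by simp
      also have "\<dots> = 1 / ln (real n)" using ln_n by (simp add: exp_minus inverse_eq_divide)
      finally have "B * exp (- g) \<le> B / ln (real n)" using B mult_left_mono by fastforce
      also have "\<dots> < \<delta>" using ln_n \<delta> by (simp add: divide_less_eq mult.commute)
      finally show ?thesis .
    qed
    have "H n \<ge> 1 - B\<^sub>1 n - B\<^sub>2 n"
      unfolding H_def B\<^sub>1_def B\<^sub>2_def I K_def
    proof (rule credible_diameter_probability)
      show "0 < p\<^sub>1 \<eta>\<^sub>1" "p\<^sub>1 \<eta>\<^sub>1 < p\<^sub>2 \<eta>\<^sub>1" "p\<^sub>2 \<eta>\<^sub>1 < 1" "0 < \<eta>\<^sub>2" "\<eta>\<^sub>2 < 1" "M > 0" by fact+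
      show "max K\<^sub>1 0 \<ge> 0" by simp
      show "k > 0" by fact
      show "D c\<^sub>n + 2 * lam / c\<^sub>n = g" by (simp add: g_def)
      show "c\<^sub>n \<in> {a..b}" "2 * c\<^sub>n \<in> {a..b}" using cn I by auto
      show "hyperprior_bound \<kappa> (3 * lam / 4) * 2 powr (1 + \<kappa>) * exp (- g) < min (p\<^sub>1 \<eta>\<^sub>1) (1 - p\<^sub>2 \<eta>\<^sub>1)"
        using small by (simp add: B_def \<delta>_def)
      show "ln c\<^sub>n \<le> g"
      proof -
        have "ln c\<^sub>n \<le> ln (real n * c\<^sub>n)" using n cn0 by (intro ln_mono) auto
        also have "\<dots> \<le> D2L \<mu> n c\<^sub>n" using D2L cn(1) by blast
        also note g_ge
        finally show ?thesis .
      qed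
      fix t assume t: "t \<in> {a..b}"
      then have t0: "t > 0" using a by simp
      have pos: "D2L \<mu> n t > 0" using D2L_ge[OF t] lnln by linarith
      show "D t > 0" using D_ge[OF t] pos by linarith
      show "D2R \<mu> n t \<le> max K\<^sub>1 0 * D2L \<mu> n t"
      proof -
        have "D2R \<mu> n t / D2L \<mu> n t \<le> max K\<^sub>1 0" using D2R t I by blast
        then show ?thesis by (simp only: pos_divide_le_eq[OF pos])
      qed
      \<comment> \<open>A zero denominator would make the quotient 0, contradicting
        \<open>k > 0\<close>; hence \<open>s2\<close> is positive, as the radius bound
        requires.\<close>
      have kt: "k \<le> D2L \<mu> n t / s2 \<mu> n t" using s2 t I by blast
      have "s2 \<mu> n t \<noteq> 0" using kt k by auto
      then show s2_pos: "s2 \<mu> n t > 0" using s2_nonneg[of t] t0 by simp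
      show "k * s2 \<mu> n t \<le> D2L \<mu> n t" using kt s2_pos by (simp add: pos_le_divide_eq)
      show "g \<le> D t + 2 * lam / t"
      proof -
        have "\<not> D t + 2 * lam / t < g" using min t0 by (simp add: is_arg_min_def g_def)
        then show ?thesis by simp
      qed
    qed
    then show "H n \<ge> 1 - B\<^sub>1 n - B\<^sub>2 n" .
  qed
  moreover have "H n \<le> 1" for n
    unfolding H_def by (rule prob_space.prob_le_1[OF prob_space_std_gaussian])
  moreover have "(\<lambda>n. 1 - B\<^sub>1 n - B\<^sub>2 n) \<longlonglongrightarrow> 1 - 0 - 0"
  proof (intro tendsto_diff tendsto_const)
    show "B\<^sub>1 \<longlonglongrightarrow> 0"
      using a1[unfolded tendsto_in_prob_def, rule_format, of "1 / 2"] unfolding B\<^sub>1_def[abs_def] by simp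
    show "B\<^sub>2 \<longlonglongrightarrow> 0"
      using a2[unfolded tendsto_in_prob_def, rule_format, of 1] unfolding B\<^sub>2_def[abs_def] by simp
  qed
  ultimately have "H \<longlonglongrightarrow> 1"
    by (intro tendsto_sandwich[of "\<lambda>n. 1 - B\<^sub>1 n - B\<^sub>2 n" H sequentially "\<lambda>_. 1"]) auto
  with K show ?thesis unfolding H_def[abs_def] by blast
qed

end
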